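(* Let $n\ge 7$ and let $G$ be a connected simple graph with $n$ vertices and $n+1$ edges whose two cycles are vertex-disjoint (i.e. $G\in\mathcal{C}(p,q)$ for some $p,q$). If $G\not\cong T_n^1(3,3)$, then $\operatorname{avm}(G)>\operatorname{avm}(T_n^1(3,3))$.
   Context: $\operatorname{avm}(G)$ is the average of $|M|$ over all maximal matchings $M$ of $G$ (a matching is maximal if not properly contained in another matching). $\mathcal{C}(p,q)$ is the class of connected graphs with $n$ vertices and $n+1$ edges containing two vertex-disjoint cycles of lengths $p$ and $q$. $T_n^1(3,3)$ is the graph obtained from two vertex-disjoint triangles $v_1v_2v_3$ and $w_1w_2w_3$ joined by the edge $v_3w_1$ by attaching $n-6\ge1$ pendant edges (new leaves) to $v_3$. *)

theory Defs
  imports Complex_Main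
begin

text \<open>A finite simple graph: finite vertex set V, edges are 2-element subsets of V.\<close>
definition simple_graph :: "'a set \<Rightarrow> 'a set set \<Rightarrow> bool" where
  "simple_graph V E \<longleftrightarrow> finite V \<and>
     (\<forall>e\<in>E. \<exists>u v. u \<in> V \<and> v \<in> V \<and> u \<noteq> v \<and> e = {u, v})"

definition adj_rel :: "'a set set \<Rightarrow> ('a \<times> 'a) set" where
  "adj_rel E = {(u, v). {u, v} \<in> E}"

definition connected_graph :: "'a set \<Rightarrow> 'a set set \<Rightarrow> bool" where
  "connected_graph V E \<longleftrightarrow> (\<forall>u\<in>V. \<forall>v\<in>V. (u, v) \<in> (adj_rel E)\<^sup>*)"

text \<open>A cycle given by its cyclic list of distinct vertices (length at least 3).\<close>
definition is_cycle :: "'a set set \<Rightarrow> 'a list \<Rightarrow> bool" where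
  "is_cycle E xs \<longleftrightarrow> length xs \<ge> 3 \<and> distinct xs \<and>
     (\<forall>i < length xs. {xs ! i, xs ! ((i + 1) mod length xs)} \<in> E)"

definition is_matching :: "'a set set \<Rightarrow> 'a set set \<Rightarrow> bool" where
  "is_matching E M \<longleftrightarrow> M \<subseteq> E \<and> (\<forall>e\<in>M. \<forall>f\<in>M. e \<noteq> f \<longrightarrow> e \<inter> f = {})"

definition is_maximal_matching :: "'a set set \<Rightarrow> 'a set set \<Rightarrow> bool" where
  "is_maximal_matching E M \<longleftrightarrow> is_matching E M \<and>
     \<not> (\<exists>M'. is_matching E M' \<and> M \<subset> M')"

text \<open>Average size of a maximal matching.\<close>
definition avm :: "'a set set \<Rightarrow> real" where
  "avm E = (\<Sum>M\<in>{M. is_maximal_matching E M}. real (card M))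
           / real (card {M. is_maximal_matching E M})"

definition graph_iso :: "'a set \<Rightarrow> 'a set set \<Rightarrow> 'b set \<Rightarrow> 'b set set \<Rightarrow> bool" where
  "graph_iso V E W F \<longleftrightarrow> (\<exists>f. bij_betw f V W \<and> (\<lambda>e. f ` e) ` E = F)"

text \<open>T_n^1(3,3) on vertices {0..<n}: triangles 0,1,2 (v1,v2,v3) and 3,4,5 (w1,w2,w3),
  bridge {2,3} (v3 w1), pendant leaves 6..n-1 attached to 2 (v3).\<close>
definition T_edges :: "nat \<Rightarrow> nat set set" where
  "T_edges n = {{0,1},{1,2},{0,2},{3,4},{4,5},{3,5},{2,3}} \<union> {{2, k} | k. 6 \<le> k \<and> k < n}"

end

theory Submission
  imports Defs
begin

text \<open>Put \<open>k = n - 6\<close>. The extremal graph has \<open>3 k + 7\<close> maximal matchings, six with two edges and the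
  others with three. In general, each of the two cycles needs two covered vertices, so every
  maximal matching has at least two edges, and it suffices that those with exactly two edges number
  fewer than \<open>6 / (3 k + 7)\<close> of all. If one exists, both cycles are triangles, it picks one edge from
  each, and all remaining vertices are adjacent to the triangles. Call an edge between a triangle
  vertex and a vertex outside both triangles a spoke. A two-edge maximal matching omits only bare
  vertices, those without a spoke. On the other hand a spoke \<open>u v\<close> at one triangle, the edge opposite
  to \<open>u\<close>, and the edge of the other triangle omitting a bare vertex extend to a larger maximal
  matching, and different choices give different matchings. One further matching decides the cases
  in which this count is just short.\<close>

section \<open>Matchings and their maximality\<close>

lemma matching_edges_eq:
  "\<lbrakk>is_matching E M; e \<in> M; f \<in> M; v \<in> e; v \<in> f\<rbrakk> \<Longrightarrow> e = f"
  unfolding is_matching_def by blast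

lemma is_matching_empty: "is_matching E {}"
  by (simp add: is_matching_def)

lemma is_matching_insert:
  "\<lbrakk>e \<in> E; is_matching E M; \<forall>f\<in>M. e \<inter> f = {}\<rbrakk> \<Longrightarrow> is_matching E (insert e M)"
  by (auto simp: is_matching_def)

lemma maximal_matching_extends:
  assumes "finite E" and "is_matching E M0"
  obtains M where "is_maximal_matching E M" and "M0 \<subseteq> M"
proof -
  have "finite {M. is_matching E M}"
    by (rule finite_subset[of _ "Pow E"]) (auto simp: is_matching_def assms)
  from finite_has_maximal2[OF this, of M0] assms(2)
  obtain M where "is_matching E M" "M0 \<subseteq> M" "\<forall>M'. is_matching E M' \<longrightarrow> M \<subseteq> M' \<longrightarrow> M = M'"
    by auto
  then show thesis
    by (intro that[of M]) (auto simp: is_maximal_matching_def)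
qed

text \<open>A larger matching would contain an edge disjoint from every edge of \<open>M\<close>, so
  maximality says that the covered vertices form a vertex cover. An edge \<open>{}\<close> would
  meet nothing, and the right-hand side would then fail for every \<open>M\<close>.\<close>

lemma maximal_matching_iff:
  assumes "{} \<notin> E"
  shows "is_maximal_matching E M \<longleftrightarrow> is_matching E M \<and> (\<forall>e\<in>E. e \<inter> \<Union>M \<noteq> {})"
proof
  assume max: "is_maximal_matching E M"
  then have M: "is_matching E M"
    by (simp add: is_maximal_matching_def)
  have "e \<inter> \<Union>M \<noteq> {}" if "e \<in> E" for e
  proof
    assume disj: "e \<inter> \<Union>M = {}"
    have "e \<noteq> {}"
      using assms that by auto
    with disj have "e \<notin> M"
      by auto
    moreover have "is_matching E (insert e M)"
      using M that disj by (auto simp: is_matching_def)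
    ultimately show False
      using max by (auto simp: is_maximal_matching_def)
  qed
  with M show "is_matching E M \<and> (\<forall>e\<in>E. e \<inter> \<Union>M \<noteq> {})"
    by blast
next
  assume M: "is_matching E M \<and> (\<forall>e\<in>E. e \<inter> \<Union>M \<noteq> {})"
  have False if M': "is_matching E M'" "M \<subset> M'" for M'
  proof -
    obtain e where e: "e \<in> M'" "e \<notin> M"
      using M' by auto
    then have "e \<in> E"
      using M' by (auto simp: is_matching_def)
    then have "e \<inter> \<Union>M \<noteq> {}"
      using M by simp
    then obtain f v where f: "f \<in> M" "v \<in> e" "v \<in> f"
      by auto
    then have "f \<in> M'"
      using M'(2) by auto
    then have "e = f"
      using matching_edges_eq[OF M'(1) e(1)] f by simp
    then show False
      using e f by simp
  qed
  with M show "is_maximal_matching E M"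
    by (auto simp: is_maximal_matching_def)
qed

lemma finite_maximal_matchings:
  "finite E \<Longrightarrow> finite {M. is_maximal_matching E M}"
  by (rule finite_subset[of _ "Pow E"]) (auto simp: is_maximal_matching_def is_matching_def)

section \<open>Cycles and their vertex covers\<close>

lemma is_cycle_edge:
  "is_cycle E c \<Longrightarrow> i < length c \<Longrightarrow> {c ! i, c ! ((i + 1) mod length c)} \<in> E"
  by (simp add: is_cycle_def)

lemma is_cycle_rotate:
  assumes "is_cycle E c"
  shows "is_cycle E (rotate m c)"
proof -
  let ?p = "length c"
  have p: "?p > 0"
    using assms by (auto simp: is_cycle_def)
  have "{rotate m c ! i, rotate m c ! ((i + 1) mod ?p)} \<in> E" if "i < ?p" for i
  proof -
    have "(m + (i + 1) mod ?p) mod ?p = ((m + i) mod ?p + 1) mod ?p"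
      by (simp add: mod_simps)
    moreover have "(m + i) mod ?p < ?p"
      using p by simp
    ultimately show ?thesis
      using assms that p by (auto simp: is_cycle_def nth_rotate)
  qed
  then show ?thesis
    using assms by (simp add: is_cycle_def)
qed

definition cycle_edges :: "'a list \<Rightarrow> 'a set set" where
  "cycle_edges c = (\<lambda>i. {c ! i, c ! ((i + 1) mod length c)}) ` {..<length c}"

lemma cycle_edges_subset: "is_cycle E c \<Longrightarrow> cycle_edges c \<subseteq> E"
  by (auto simp: cycle_edges_def is_cycle_def)

lemma cycle_edges_in_set: "e \<in> cycle_edges c \<Longrightarrow> e \<subseteq> set c"
  by (cases "c = []") (auto simp: cycle_edges_def intro!: nth_mem)

lemma card_cycle_edges:
  assumes "is_cycle E c"
  shows "card (cycle_edges c) = length c"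
proof -
  let ?p = "length c"
  have p: "3 \<le> ?p" and d: "distinct c"
    using assms by (auto simp: is_cycle_def)
  have "inj_on (\<lambda>i. {c ! i, c ! ((i + 1) mod ?p)}) {..<?p}"
  proof (rule inj_onI)
    fix i j
    assume ij: "i \<in> {..<?p}" "j \<in> {..<?p}"
      and eq: "{c ! i, c ! ((i + 1) mod ?p)} = {c ! j, c ! ((j + 1) mod ?p)}"
    have lt: "(i + 1) mod ?p < ?p" "(j + 1) mod ?p < ?p"
      using p by (simp_all only: mod_less_divisor)
    from eq have "i = j \<or> i = (j + 1) mod ?p \<and> (i + 1) mod ?p = j"
      using ij lt d by (auto simp: doubleton_eq_iff nth_eq_iff_index_eq)
    then show "i = j"
    proof
      \<comment> \<open>Each index would be the cyclic successor of the other, which happens only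
        for length at most 2.\<close>
      assume h: "i = (j + 1) mod ?p \<and> (i + 1) mod ?p = j"
      then show "i = j"
        using ij p by (simp add: mod_Suc split: if_splits)
    qed
  qed
  then show ?thesis
    by (simp add: cycle_edges_def card_image)
qed

lemma cycle_edge_first:
  assumes "is_cycle E c" and "e \<in> cycle_edges c"
  obtains c' where "is_cycle E c'" and "set c' = set c" and "e = {c' ! 0, c' ! 1}"
proof -
  obtain i where i: "i < length c" "e = {c ! i, c ! ((i + 1) mod length c)}"
    using assms(2) by (auto simp: cycle_edges_def)
  have "length c \<ge> 3" "c \<noteq> []"
    using assms(1) by (auto simp: is_cycle_def)
  with i have "e = {rotate i c ! 0, rotate i c ! 1}"
    by (simp add: nth_rotate)
  then show thesis
    using that[of "rotate i c"] is_cycle_rotate[OF assms(1)] by auto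
qed

text \<open>A single vertex misses some edge of the cycle: after a rotation that puts it at position
  0, the edge between positions 1 and 2 avoids it. If \<open>C\<close> misses the cycle altogether,
  any position serves for that vertex.\<close>

lemma cycle_cover_ge_2:
  assumes c: "is_cycle E c" and cover: "\<forall>e\<in>E. e \<inter> C \<noteq> {}"
  shows "2 \<le> card (C \<inter> set c)"
proof (rule ccontr)
  assume "\<not> 2 \<le> card (C \<inter> set c)"
  then have le: "card (C \<inter> set c) \<le> Suc 0"
    by simp
  have p: "3 \<le> length c" and d: "distinct c"
    using c by (auto simp: is_cycle_def)
  have "\<exists>i<length c. C \<inter> set c \<subseteq> {c ! i}"
  proof (cases "C \<inter> set c = {}")
    case True
    then show ?thesis
      using p by (intro exI[of _ 0]) auto
  next
    case False
    then obtain v where v: "v \<in> C" "v \<in> set c"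
      by auto
    then have "C \<inter> set c \<subseteq> {v}"
      using le by (auto simp: card_le_Suc0_iff_eq)
    then show ?thesis
      using v by (auto simp: in_set_conv_nth)
  qed
  then obtain i where i: "i < length c" "C \<inter> set c \<subseteq> {c ! i}"
    by blast
  define c' where "c' = rotate i c"
  have c': "is_cycle E c'"
    unfolding c'_def by (rule is_cycle_rotate[OF c])
  have len: "length c' = length c"
    by (simp add: c'_def)
  have C: "C \<inter> set c' \<subseteq> {c' ! 0}"
    using i by (cases c) (simp_all add: c'_def nth_rotate)
  have "{c' ! 1, c' ! 2} \<in> E"
    using is_cycle_edge[OF c', of 1] p len by (simp add: numeral_2_eq_2)
  then have "c' ! 1 \<in> C \<or> c' ! 2 \<in> C"
    by (auto dest: bspec[OF cover])
  moreover have "c' ! 1 \<in> set c'" "c' ! 2 \<in> set c'"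
    using p len by (auto intro!: nth_mem)
  ultimately have "c' ! 1 = c' ! 0 \<or> c' ! 2 = c' ! 0"
    using C by auto
  moreover have "distinct c'" "c' \<noteq> []" "c \<noteq> []"
    using c c' by (auto simp: is_cycle_def)
  ultimately show False
    using p len by (auto simp: nth_eq_iff_index_eq)
qed

text \<open>Rotate so that the two covered vertices are at positions 0 and 1. From length 4 on, the
  edge between positions 2 and 3 would be uncovered, so the cycle is a triangle. Its edges are named
  by the opposite vertex \<open>w\<close>, the form used in all later counts.\<close>

lemma cycle_covered_by_edge:
  assumes c: "is_cycle E c" and cover: "\<forall>e\<in>E. e \<inter> C \<noteq> {}"
    and e: "C \<inter> set c \<in> cycle_edges c"
  shows "card (set c) = 3" and "w \<in> set c \<Longrightarrow> set c - {w} \<in> E"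
proof -
  obtain c' where c': "is_cycle E c'" "set c' = set c" "C \<inter> set c = {c' ! 0, c' ! 1}"
    using cycle_edge_first[OF c e] .
  have p: "3 \<le> length c'" and d: "distinct c'" and ne: "c' \<noteq> []"
    using c' by (auto simp: is_cycle_def)
  have "\<not> 4 \<le> length c'"
  proof
    assume p4: "4 \<le> length c'"
    then have "{c' ! 2, c' ! 3} \<in> E"
      using is_cycle_edge[OF c'(1), of 2] by simp
    then have "c' ! 2 \<in> C \<or> c' ! 3 \<in> C"
      by (auto dest: bspec[OF cover])
    moreover have "c' ! 2 \<in> set c" "c' ! 3 \<in> set c"
      using p4 c'(2) by (auto intro!: nth_mem)
    moreover have "c' ! 2 \<notin> {c' ! 0, c' ! 1}" "c' ! 3 \<notin> {c' ! 0, c' ! 1}"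
      using p4 d ne by (auto simp: nth_eq_iff_index_eq)
    ultimately show False
      using c'(3) by blast
  qed
  with p have len: "length c' = 3"
    by simp
  then show "card (set c) = 3"
    using d c'(2) by (metis distinct_card)
  from len obtain x y z where xyz: "c' = [x, y, z]"
    by (auto simp: eval_nat_numeral length_Suc_conv)
  have "{x, y} \<in> E" "{y, z} \<in> E" "{z, x} \<in> E"
    using is_cycle_edge[OF c'(1), of 0] is_cycle_edge[OF c'(1), of 1]
      is_cycle_edge[OF c'(1), of 2] xyz by simp_all
  moreover have "{x, y, z} - {x} = {y, z}" "{x, y, z} - {y} = {z, x}" "{x, y, z} - {z} = {x, y}"
    using d xyz by auto
  moreover have "w = x \<or> w = y \<or> w = z" and "set c = {x, y, z}" if "w \<in> set c"
    using that unfolding c'(2)[symmetric] xyz by auto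
  ultimately show "set c - {w} \<in> E" if "w \<in> set c"
    using that by metis
qed

section \<open>Graphs with two disjoint cycles and the structure forced by a two-edge maximal
  matching\<close>

locale disjoint_cycles =
  fixes V :: "'a set" and E :: "'a set set" and c1 c2 :: "'a list"
  assumes simple: "simple_graph V E"
    and conn: "connected_graph V E"
    and card_E: "card E = card V + 1"
    and cycle1: "is_cycle E c1"
    and cycle2: "is_cycle E c2"
    and disj: "set c1 \<inter> set c2 = {}"
begin

abbreviation "X \<equiv> set c1 \<union> set c2"

text \<open>The cycles have symmetric roles; facts proved for \<open>c1\<close> are carried over to
  \<open>c2\<close> by this.\<close>

lemma swap: "disjoint_cycles V E c2 c1"
  using simple conn card_E cycle1 cycle2 disj by unfold_locales auto

lemma finite_V: "finite V"
  using simple by (simp add: simple_graph_def)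

text \<open>Infinite sets have \<open>card\<close> 0, whereas \<open>card_E\<close> makes
  \<open>card E\<close> positive.\<close>

lemma finite_E: "finite E"
  using card_E by (metis add_is_0 card.infinite one_neq_zero)

lemma edgeE:
  assumes "e \<in> E"
  obtains u v where "u \<in> V" "v \<in> V" "u \<noteq> v" "e = {u, v}"
  using simple assms unfolding simple_graph_def by blast

lemma card_edge: "e \<in> E \<Longrightarrow> card e = 2"
  by (elim edgeE) simp

lemma edge_subset: "e \<in> E \<Longrightarrow> e \<subseteq> V"
  by (elim edgeE) simp

lemma empty_not_edge: "{} \<notin> E"
  using card_edge by fastforce

lemma cycle1_subset: "set c1 \<subseteq> V"
proof
  fix v
  assume "v \<in> set c1"
  then obtain i where "i < length c1" "v = c1 ! i"
    by (auto simp: in_set_conv_nth)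
  then show "v \<in> V"
    using edge_subset[OF is_cycle_edge[OF cycle1]] by auto
qed

lemmas cycle2_subset = disjoint_cycles.cycle1_subset[OF swap]

lemma maximal_matching_covers:
  "is_maximal_matching E M \<Longrightarrow> \<forall>e\<in>E. e \<inter> \<Union>M \<noteq> {}"
  using maximal_matching_iff[OF empty_not_edge] by simp

lemma maximal_matching_subset:
  "is_maximal_matching E M \<Longrightarrow> M \<subseteq> E"
  by (simp add: is_maximal_matching_def is_matching_def)

lemma card_Union_matching:
  assumes "is_matching E M"
  shows "card (\<Union>M) = 2 * card M"
proof -
  have M: "M \<subseteq> E"
    using assms by (simp add: is_matching_def)
  have "card (\<Union>M) = sum card M"
  proof (rule card_Union_disjoint)
    show "pairwise disjnt M"
      using assms by (auto simp: is_matching_def pairwise_def disjnt_def)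
    show "finite e" if "e \<in> M" for e
      using that M finite_subset[OF edge_subset finite_V] by blast
  qed
  also have "\<dots> = (\<Sum>e\<in>M. 2)"
    using M card_edge by (intro sum.cong) auto
  finally show ?thesis
    by simp
qed

lemma finite_Union_matching:
  "is_maximal_matching E M \<Longrightarrow> finite (\<Union>M)"
  using maximal_matching_subset edge_subset finite_V by (meson Sup_least finite_subset subsetD)

lemma card_cover_split:
  assumes "is_maximal_matching E M"
  shows "card (\<Union>M \<inter> set c1) + card (\<Union>M \<inter> set c2) = card (\<Union>M \<inter> X)"
    and "card (\<Union>M \<inter> X) \<le> 2 * card M"
proof -
  show "card (\<Union>M \<inter> set c1) + card (\<Union>M \<inter> set c2) = card (\<Union>M \<inter> X)"
    using disj unfolding Int_Un_distrib by (subst card_Un_disjoint) auto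
  have "card (\<Union>M \<inter> X) \<le> card (\<Union>M)"
    using finite_Union_matching[OF assms] by (intro card_mono) auto
  then show "card (\<Union>M \<inter> X) \<le> 2 * card M"
    using card_Union_matching assms by (simp add: is_maximal_matching_def)
qed

lemma card_maximal_matching_ge_2:
  assumes "is_maximal_matching E M"
  shows "2 \<le> card M"
  using card_cover_split[OF assms]
    cycle_cover_ge_2[OF cycle1 maximal_matching_covers[OF assms]]
    cycle_cover_ge_2[OF cycle2 maximal_matching_covers[OF assms]] by linarith

text \<open>Two edges cover four vertices, and each cycle already requires two of them. Both lower
  bounds are therefore attained, and no covered vertex is left outside the cycles.\<close>

lemma small_matching_cover:
  assumes M: "is_maximal_matching E M" and "card M = 2"
  shows "card (\<Union>M \<inter> set c1) = 2" and "card (\<Union>M \<inter> set c2) = 2" and "\<Union>M \<subseteq> X"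
proof -
  note ge = cycle_cover_ge_2[OF cycle1 maximal_matching_covers[OF M]]
    cycle_cover_ge_2[OF cycle2 maximal_matching_covers[OF M]]
  show "card (\<Union>M \<inter> set c1) = 2" "card (\<Union>M \<inter> set c2) = 2"
    using card_cover_split[OF M] ge assms(2) by linarith+
  have "card (\<Union>M \<inter> X) = card (\<Union>M)"
    using card_cover_split[OF M] ge card_Union_matching[of M] assms
    by (simp add: is_maximal_matching_def)
  then have "\<Union>M \<inter> X = \<Union>M"
    using finite_Union_matching[OF M] by (intro card_subset_eq) auto
  then show "\<Union>M \<subseteq> X"
    by blast
qed

text \<open>A walk from a vertex of \<open>Y\<close> to a vertex outside must leave \<open>Y\<close>
  at some step.\<close>

lemma leaving_edge:
  assumes "Y \<subseteq> V" "Y \<noteq> {}" "Y \<noteq> V"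
  obtains p q where "p \<in> Y" "q \<in> V - Y" "{p, q} \<in> E"
proof -
  obtain a b where ab: "a \<in> Y" "b \<in> V" "b \<notin> Y"
    using assms by blast
  then have "(a, b) \<in> (adj_rel E)\<^sup>*"
    using conn assms by (auto simp: connected_graph_def)
  then have "\<exists>p q. p \<in> Y \<and> q \<notin> Y \<and> (p, q) \<in> adj_rel E"
    using ab(1,3)
  proof (induction rule: rtrancl_induct)
    case (step y z)
    then show ?case
      by (cases "y \<in> Y") auto
  qed simp
  then obtain p q where "p \<in> Y" "q \<notin> Y" "{p, q} \<in> E"
    by (auto simp: adj_rel_def)
  moreover from this have "q \<in> V"
    using edge_subset by blast
  ultimately show thesis
    using that by blast
qed

lemma cycles_nonempty: "set c1 \<noteq> {}" "set c2 \<noteq> {}"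
  using cycle1 cycle2 by (auto simp: is_cycle_def)

lemma small_matching_edge_meets_cycles:
  assumes "is_maximal_matching E M" "card M = 2" "e \<in> E"
  shows "e \<inter> X \<noteq> {}"
  using maximal_matching_covers[OF assms(1)] small_matching_cover(3)[OF assms(1,2)] assms(3)
  by blast

text \<open>A maximal matching with two edges covers all edges by cycle vertices, so every other vertex
  hangs on a cycle; counting then leaves exactly one further edge, the one joining the cycles.\<close>

lemma small_matching_edges:
  assumes M: "is_maximal_matching E M" "card M = 2"
  obtains h g where
    "\<forall>v\<in>V - X. h v \<in> X"
    and "E = cycle_edges c1 \<union> cycle_edges c2 \<union> (\<lambda>v. {v, h v}) ` (V - X) \<union> {g}"
    and "(\<exists>x\<in>set c1. \<exists>y\<in>set c2. g = {x, y}) \<or>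
      (\<exists>z\<in>V - X. h z \<in> set c1 \<and> (\<exists>y\<in>set c2. g = {z, y}) \<or>
        h z \<in> set c2 \<and> (\<exists>x\<in>set c1. g = {z, x}))"
proof -
  have XV: "X \<subseteq> V"
    using cycle1_subset cycle2_subset by blast
  have "\<exists>w. w \<in> X \<and> {v, w} \<in> E" if v: "v \<in> V - X" for v
  proof -
    obtain a where "a \<in> set c1"
      using cycles_nonempty(1) by (meson ex_in_conv)
    then have "a \<in> V" "a \<noteq> v"
      using v cycle1_subset by auto
    then have "{v} \<noteq> V"
      by blast
    then obtain w where w: "{v, w} \<in> E"
      using v leaving_edge[of "{v}"] by blast
    then have "w \<in> X"
      using small_matching_edge_meets_cycles[OF M w] v by blast
    with w show ?thesis
      by blast
  qed
  then obtain h where hX: "\<And>v. v \<in> V - X \<Longrightarrow> h v \<in> X" and hE: "\<And>v. v \<in> V - X \<Longrightarrow> {v, h v} \<in> E"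
    by metis
  let ?H = "(\<lambda>v. {v, h v}) ` (V - X)"
  let ?P = "\<lambda>g. (\<exists>x\<in>set c1. \<exists>y\<in>set c2. g = {x, y}) \<or>
      (\<exists>z\<in>V - X. h z \<in> set c1 \<and> (\<exists>y\<in>set c2. g = {z, y}) \<or>
        h z \<in> set c2 \<and> (\<exists>x\<in>set c1. g = {z, x}))"
  \<comment> \<open>\<open>?Y\<close> is the first cycle together with the outer vertices whose
    chosen neighbour lies on it. An edge leaving \<open>?Y\<close> links the two cycles, either
    directly or through one outer vertex \<open>z\<close>.\<close>
  let ?Y = "set c1 \<union> {z \<in> V - X. h z \<in> set c1}"
  have "\<exists>g\<in>E. ?P g"
  proof -
    obtain b where "b \<in> set c2"
      using cycles_nonempty(2) by (meson ex_in_conv)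
    then have "b \<in> V" "b \<notin> ?Y"
      using XV disj by auto
    then have "?Y \<noteq> V"
      by blast
    moreover have "?Y \<subseteq> V" "?Y \<noteq> {}"
      using XV cycles_nonempty(1) by auto
    ultimately obtain p q where pq: "p \<in> ?Y" "q \<in> V - ?Y" "{p, q} \<in> E"
      using leaving_edge[of ?Y] by blast
    have "p \<in> X \<or> q \<in> X"
      using small_matching_edge_meets_cycles[OF M pq(3)] by blast
    then have "?P {p, q}"
      using pq(1,2) hX[of q] by (cases "q \<in> X"; cases "p \<in> X") (auto simp: insert_commute)
    with pq(3) show ?thesis
      by blast
  qed
  then obtain g where g: "g \<in> E" "?P g"
    by blast
  \<comment> \<open>The cycle edges number as many as the cycle vertices, and the chosen edges as
    many as the outer vertices. Together they make \<open>card V\<close> edges, one fewer than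
    \<open>card E\<close>, so a linking edge \<open>g\<close> outside \<open>?B\<close> completes
    the edge set.\<close>
  let ?B = "cycle_edges c1 \<union> cycle_edges c2 \<union> ?H"
  have fin: "finite (cycle_edges c1)" "finite (cycle_edges c2)" "finite ?H"
    using finite_V by (simp_all add: cycle_edges_def)
  have c1X: "e \<subseteq> set c1 \<and> e \<noteq> {}" if "e \<in> cycle_edges c1" for e
    using that cycle_edges_in_set cycle_edges_subset[OF cycle1] empty_not_edge by blast
  have c2X: "e \<subseteq> set c2 \<and> e \<noteq> {}" if "e \<in> cycle_edges c2" for e
    using that cycle_edges_in_set cycle_edges_subset[OF cycle2] empty_not_edge by blast
  have H: "\<not> e \<subseteq> X" if "e \<in> ?H" for e
    using that by blast
  have "card ?B = card (cycle_edges c1) + card (cycle_edges c2) + card ?H"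
  proof (subst card_Un_disjoint)
    show "(cycle_edges c1 \<union> cycle_edges c2) \<inter> ?H = {}"
      using c1X c2X H by blast
    have "cycle_edges c1 \<inter> cycle_edges c2 = {}"
      using c1X c2X disj by blast
    then show "card (cycle_edges c1 \<union> cycle_edges c2) + card ?H =
        card (cycle_edges c1) + card (cycle_edges c2) + card ?H"
      using fin by (simp add: card_Un_disjoint)
  qed (use fin in auto)
  also have "card (cycle_edges c1) = card (set c1)"
    using card_cycle_edges[OF cycle1] cycle1 by (simp add: is_cycle_def distinct_card)
  also have "card (cycle_edges c2) = card (set c2)"
    using card_cycle_edges[OF cycle2] cycle2 by (simp add: is_cycle_def distinct_card)
  also have "card ?H = card (V - X)"
  proof (rule card_image, rule inj_onI)
    fix u v
    assume "u \<in> V - X" "v \<in> V - X" "{u, h u} = {v, h v}"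
    then show "u = v"
      using hX by (metis DiffD2 doubleton_eq_iff)
  qed
  also have "card (set c1) + card (set c2) = card X"
    using disj by (simp add: card_Un_disjoint)
  also have "card X + card (V - X) = card V"
    using XV finite_V by (metis List.finite_set card_Diff_subset card_mono finite_UnI le_add_diff_inverse)
  finally have cardB: "card ?B = card V" .
  have "g \<notin> ?B"
  proof
    assume "g \<in> ?B"
    then consider "g \<subseteq> set c1" | "g \<subseteq> set c2" | v where "v \<in> V - X" "g = {v, h v}"
      using c1X c2X by blast
    then show False
    proof cases
      case 1
      then show False
        using g(2) disj by auto
    next
      case 2
      then show False
        using g(2) disj by auto
    next
      case 3
      then have "h v \<in> X" "v \<notin> X"
        using hX by auto
      then show False
        using g(2) disj 3 by (auto simp: doubleton_eq_iff)
    qed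
  qed
  then have "card (?B \<union> {g}) = card E"
    using cardB card_E fin by simp
  moreover have "?B \<union> {g} \<subseteq> E"
    using g(1) hE cycle_edges_subset[OF cycle1] cycle_edges_subset[OF cycle2] by blast
  ultimately have "?B \<union> {g} = E"
    using finite_E by (intro card_subset_eq)
  then show thesis
    using that[of h g] hX g(2) by blast
qed

end

section \<open>Counting maximal matchings around two triangles\<close>

definition spokes :: "'a set set \<Rightarrow> 'a set \<Rightarrow> 'a set \<Rightarrow> ('a \<times> 'a) set" where
  "spokes E U T = {(u, v). u \<in> T \<and> v \<in> U \<and> {u, v} \<in> E}"

definition bare :: "'a set set \<Rightarrow> 'a set \<Rightarrow> 'a set \<Rightarrow> 'a set" where
  "bare E U T = T - fst ` spokes E U T"

text \<open>\<open>U\<close> is the set of vertices outside both triangles, and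
  \<open>T1 - {w}\<close> is the triangle edge opposite \<open>w\<close>. The edge count of the
  graph enters later, through lower bounds on the number of spokes.\<close>

locale linked_triangles =
  fixes E :: "'a set set" and T1 T2 U :: "'a set"
  assumes finite_E: "finite E"
    and finite_U: "finite U"
    and card_edge: "\<And>e. e \<in> E \<Longrightarrow> card e = 2"
    and disj: "T1 \<inter> T2 = {}" "T1 \<inter> U = {}" "T2 \<inter> U = {}"
    and card_T1: "card T1 = 3"
    and card_T2: "card T2 = 3"
    and T1_edge: "\<And>w. w \<in> T1 \<Longrightarrow> T1 - {w} \<in> E"
    and T2_edge: "\<And>w. w \<in> T2 \<Longrightarrow> T2 - {w} \<in> E"
    and small_matching: "\<And>M. is_maximal_matching E M \<Longrightarrow> card M = 2 \<Longrightarrow>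
      \<exists>w1\<in>T1. \<exists>w2\<in>T2. M = {T1 - {w1}, T2 - {w2}}"
begin

lemma swap: "linked_triangles E T2 T1 U"
proof
  show "\<exists>w1\<in>T2. \<exists>w2\<in>T1. M = {T2 - {w1}, T1 - {w2}}"
    if "is_maximal_matching E M" "card M = 2" for M
    using small_matching[OF that] by (metis insert_commute)
qed (use finite_E finite_U card_edge disj card_T1 card_T2 T1_edge T2_edge in auto)

lemma finite_T: "finite T1" "finite T2"
  using card_T1 card_T2 by (auto intro: card_ge_0_finite)

lemma empty_not_edge: "{} \<notin> E"
  using card_edge by fastforce

lemma triangle_edge_nonempty: "w \<in> T1 \<Longrightarrow> T1 - {w} \<noteq> {}"
  using T1_edge empty_not_edge by metis

definition large_matchings :: "'a set set set" where
  "large_matchings = {M. is_maximal_matching E M \<and> 3 \<le> card M}"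

definition small_matchings :: "'a set set set" where
  "small_matchings = {M. is_maximal_matching E M \<and> card M = 2}"

text \<open>Membership is by containment: a partial matching of the three displayed edges can have
  several maximal extensions, and the set holds all of them. Disjointness of the two families then
  does not depend on chosen extensions.\<close>

definition spoke_matchings :: "'a set \<Rightarrow> 'a set \<Rightarrow> 'a set set set" where
  "spoke_matchings T T' = {M. is_maximal_matching E M \<and>
    (\<exists>(u, v)\<in>spokes E U T. \<exists>w\<in>bare E U T'. {u, v} \<in> M \<and> T - {u} \<in> M \<and> T' - {w} \<in> M)}"

lemma finite_matchings: "finite large_matchings" "finite small_matchings"
  "finite (spoke_matchings T T')"
  using finite_maximal_matchings[OF finite_E]
  by (auto simp: large_matchings_def small_matchings_def spoke_matchings_def elim!: rev_finite_subset)

lemma maximal_matchingD: "is_maximal_matching E M \<Longrightarrow> is_matching E M" "is_maximal_matching E M \<Longrightarrow> M \<subseteq> E"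
  by (auto simp: is_maximal_matching_def is_matching_def)

lemma finite_matching: "is_maximal_matching E M \<Longrightarrow> finite M"
  using maximal_matchingD(2) finite_E finite_subset by blast

lemma card_ge_3:
  assumes "is_maximal_matching E M" "{a, b, c} \<subseteq> M" "a \<noteq> b" "a \<noteq> c" "b \<noteq> c"
  shows "3 \<le> card M"
  using card_mono[OF finite_matching[OF assms(1)] assms(2)] assms(3-) by simp

lemma spoke_matchings_large: "spoke_matchings T1 T2 \<subseteq> large_matchings"
proof
  fix M
  assume "M \<in> spoke_matchings T1 T2"
  then obtain u v w where M: "is_maximal_matching E M" and uv: "(u, v) \<in> spokes E U T1"
    and w: "w \<in> bare E U T2" and sub: "{{u, v}, T1 - {u}, T2 - {w}} \<subseteq> M"
    by (auto simp: spoke_matchings_def)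
  have u: "u \<in> T1" "v \<in> U"
    using uv by (auto simp: spokes_def)
  have "w \<in> T2"
    using w by (simp add: bare_def)
  have "{u, v} \<noteq> T1 - {u}" "{u, v} \<noteq> T2 - {w}"
    using u disj by auto
  moreover have "T1 - {u} \<noteq> T2 - {w}"
    using triangle_edge_nonempty[OF u(1)] disj(1) by blast
  ultimately show "M \<in> large_matchings"
    using card_ge_3[OF M sub] M by (simp add: large_matchings_def)
qed

lemma finite_spokes: "finite (spokes E U T1)" "finite (spokes E U T2)"
  using finite_T finite_U
  by (auto intro: finite_subset[of _ "T1 \<times> U"] finite_subset[of _ "T2 \<times> U"] simp: spokes_def)

text \<open>Two edges of a triangle share a vertex, so a matching contains at most one of
  them.\<close>

lemma triangle_complement_eq:
  assumes M: "is_matching E M" and "T1 - {u} \<in> M" "T1 - {u'} \<in> M" "u \<in> T1" "u' \<in> T1"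
  shows "u = u'"
proof -
  have "card {u, u'} < card T1"
    using card_T1 by (simp add: card_insert_if)
  then have "\<not> T1 \<subseteq> {u, u'}"
    using card_mono[of "{u, u'}" T1] by auto
  then obtain z where "z \<in> T1 - {u}" "z \<in> T1 - {u'}"
    by auto
  then have "T1 - {u} = T1 - {u'}"
    using matching_edges_eq[OF M assms(2,3)] by blast
  then show ?thesis
    using assms(4,5) by blast
qed

text \<open>Choose a maximal extension \<open>\<phi>\<close> for each pair of a spoke and a bare
  vertex. The pair can be recovered from the extension: its unique edge in each triangle gives
  \<open>u\<close> and \<open>w\<close>, and then its edge at \<open>u\<close> gives
  \<open>v\<close>.\<close>

lemma card_spoke_matchings:
  "card (spokes E U T1) * card (bare E U T2) \<le> card (spoke_matchings T1 T2)"
proof -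
  interpret swapped: linked_triangles E T2 T1 U
    by (rule swap)
  let ?I = "spokes E U T1 \<times> bare E U T2"
  let ?Q = "\<lambda>((u, v), w) M. is_maximal_matching E M \<and> {u, v} \<in> M \<and> T1 - {u} \<in> M \<and> T2 - {w} \<in> M"
  have "\<exists>M. ?Q i M" if "i \<in> ?I" for i
  proof -
    obtain u v w where i: "i = ((u, v), w)"
      by (metis prod.exhaust)
    have uvw: "u \<in> T1" "v \<in> U" "{u, v} \<in> E" "w \<in> T2"
      using that i by (auto simp: spokes_def bare_def)
    then have "{u, v} \<inter> (T1 - {u}) = {}" "{u, v} \<inter> (T2 - {w}) = {}" "(T1 - {u}) \<inter> (T2 - {w}) = {}"
      using disj by auto
    then have "is_matching E {{u, v}, T1 - {u}, T2 - {w}}"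
      using T1_edge T2_edge uvw
      by (intro is_matching_insert is_matching_empty) auto
    from maximal_matching_extends[OF finite_E this] show ?thesis
      using i by auto
  qed
  then have "\<forall>i\<in>?I. \<exists>M. ?Q i M"
    by (rule ballI)
  from bchoice[OF this] obtain \<phi> where "\<forall>i\<in>?I. ?Q i (\<phi> i)" ..
  note \<phi> = bspec[OF this]
  have "inj_on \<phi> ?I"
  proof (rule inj_onI)
    fix i j
    assume i: "i \<in> ?I" and j: "j \<in> ?I" and eq: "\<phi> i = \<phi> j"
    obtain u v w u' v' w' where ij: "i = ((u, v), w)" "j = ((u', v'), w')"
      by (metis prod.exhaust)
    have mem: "u \<in> T1" "u' \<in> T1" "v \<in> U" "v' \<in> U" "w \<in> T2" "w' \<in> T2"
      using i j ij by (auto simp: spokes_def bare_def)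
    have M: "is_matching E (\<phi> i)" "{u, v} \<in> \<phi> i" "T1 - {u} \<in> \<phi> i" "T2 - {w} \<in> \<phi> i"
      "{u', v'} \<in> \<phi> i" "T1 - {u'} \<in> \<phi> i" "T2 - {w'} \<in> \<phi> i"
      using \<phi>[OF i] \<phi>[OF j] eq ij maximal_matchingD(1) by auto
    have "u = u'"
      using triangle_complement_eq[OF M(1,3,6)] mem by simp
    moreover have "w = w'"
      using swapped.triangle_complement_eq[OF M(1,4,7)] mem by simp
    moreover have "{u, v} = {u', v'}"
      using matching_edges_eq[OF M(1,2,5), of u] \<open>u = u'\<close> by simp
    ultimately show "i = j"
      using ij by (auto simp: doubleton_eq_iff)
  qed
  moreover have "\<phi> ` ?I \<subseteq> spoke_matchings T1 T2"
  proof
    fix M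
    assume "M \<in> \<phi> ` ?I"
    then obtain u v w where i: "((u, v), w) \<in> ?I" "M = \<phi> ((u, v), w)"
      by auto
    then show "M \<in> spoke_matchings T1 T2"
      using \<phi>[OF i(1)] by (auto simp: spoke_matchings_def)
  qed
  ultimately have "card ?I \<le> card (spoke_matchings T1 T2)"
    using finite_matchings(3) by (metis card_inj_on_le)
  then show ?thesis
    by (simp add: card_cartesian_product)
qed

text \<open>The one edge of \<open>T2\<close> in \<open>M\<close> is opposite a bare vertex, hence
  not opposite the end of a spoke. This separates the two families from each other and from further
  matchings.\<close>

lemma spoke_matching_avoids:
  assumes "M \<in> spoke_matchings T1 T2" "u \<in> fst ` spokes E U T2"
  shows "T2 - {u} \<notin> M"
proof
  interpret swapped: linked_triangles E T2 T1 U
    by (rule swap)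
  assume u: "T2 - {u} \<in> M"
  obtain w where w: "is_matching E M" "T2 - {w} \<in> M" "w \<in> bare E U T2"
    using assms(1) maximal_matchingD(1) by (auto simp: spoke_matchings_def)
  have "u \<in> T2" "w \<in> T2"
    using assms(2) w(3) by (auto simp: bare_def spokes_def)
  then have "w = u"
    using swapped.triangle_complement_eq[OF w(1,2) u] by simp
  then show False
    using assms(2) w(3) by (simp add: bare_def)
qed

lemma spoke_matchings_disjoint: "spoke_matchings T1 T2 \<inter> spoke_matchings T2 T1 = {}"
proof -
  have False if M: "M \<in> spoke_matchings T1 T2" "M \<in> spoke_matchings T2 T1" for M
  proof -
    obtain u v where "(u, v) \<in> spokes E U T2" "T2 - {u} \<in> M"
      using M(2) by (auto simp: spoke_matchings_def)
    then show False
      using spoke_matching_avoids[OF M(1), of u] by (metis fst_conv imageI)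
  qed
  then show ?thesis
    by blast
qed

text \<open>\<open>Z\<close> makes room for matchings that belong to neither spoke family; it is
  instantiated with the empty set or with a singleton.\<close>

lemma card_large_matchings:
  assumes "Z \<subseteq> large_matchings" "Z \<inter> spoke_matchings T1 T2 = {}" "Z \<inter> spoke_matchings T2 T1 = {}"
  shows "card (spokes E U T1) * card (bare E U T2) + card (spokes E U T2) * card (bare E U T1) + card Z
    \<le> card large_matchings"
proof -
  interpret swapped: linked_triangles E T2 T1 U
    by (rule swap)
  have "finite Z"
    using assms(1) finite_matchings(1) finite_subset by blast
  then have "card (spoke_matchings T1 T2) + card (spoke_matchings T2 T1) + card Z
      = card (spoke_matchings T1 T2 \<union> spoke_matchings T2 T1 \<union> Z)"
    using assms(2,3) spoke_matchings_disjoint finite_matchings(3)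
    by (subst card_Un_disjoint, auto)+
  also have "\<dots> \<le> card large_matchings"
    using spoke_matchings_large swapped.spoke_matchings_large assms(1) finite_matchings(1)
    by (intro card_mono) auto
  finally show ?thesis
    using card_spoke_matchings swapped.card_spoke_matchings by linarith
qed

text \<open>Exactly one vertex of each triangle is left uncovered, and so is all of
  \<open>U\<close>. No edge may join uncovered vertices, so both omitted vertices are bare and not
  adjacent to each other.\<close>

lemma small_matchings_subset:
  "small_matchings \<subseteq> (\<lambda>(w1, w2). {T1 - {w1}, T2 - {w2}}) `
    {(w1, w2) \<in> bare E U T1 \<times> bare E U T2. {w1, w2} \<notin> E}"
proof
  fix M
  assume "M \<in> small_matchings"
  then have M: "is_maximal_matching E M" "card M = 2"
    by (auto simp: small_matchings_def)
  then obtain w1 w2 where w: "w1 \<in> T1" "w2 \<in> T2" "M = {T1 - {w1}, T2 - {w2}}"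
    using small_matching by blast
  have uncovered: "e \<notin> E" if "e \<subseteq> {w1, w2} \<union> U" for e
  proof
    assume "e \<in> E"
    then have "e \<inter> \<Union>M \<noteq> {}"
      using M(1) maximal_matching_iff[OF empty_not_edge] by simp
    then show False
      using that w disj by auto
  qed
  have "{w1, v} \<notin> E" "{w2, v} \<notin> E" if "v \<in> U" for v
    using that by (auto intro!: uncovered)
  then have "w1 \<in> bare E U T1" "w2 \<in> bare E U T2"
    using w by (auto simp: bare_def spokes_def)
  moreover have "{w1, w2} \<notin> E"
    by (auto intro!: uncovered)
  ultimately show "M \<in> (\<lambda>(w1, w2). {T1 - {w1}, T2 - {w2}}) `
    {(w1, w2) \<in> bare E U T1 \<times> bare E U T2. {w1, w2} \<notin> E}"
    by (intro image_eqI[of _ _ "(w1, w2)"]) (simp_all add: w(3))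
qed

lemma finite_bare: "finite (bare E U T1)" "finite (bare E U T2)"
  using finite_T by (simp_all add: bare_def)

lemma card_small_matchings:
  assumes "{(w1, w2) \<in> bare E U T1 \<times> bare E U T2. {w1, w2} \<notin> E} \<subseteq> P" "finite P"
  shows "card small_matchings \<le> card P"
  using surj_card_le[OF assms(2) order_trans[OF small_matchings_subset image_mono[OF assms(1)]]] .

lemma card_small_matchings_le:
  "card small_matchings \<le> card (bare E U T1) * card (bare E U T2)"
  using card_small_matchings[of "bare E U T1 \<times> bare E U T2"] finite_bare
  by (auto simp: card_cartesian_product)

lemma card_bare:
  assumes "(u, v) \<in> spokes E U T1"
  shows "card (bare E U T1) \<le> 2"
proof -
  have "u \<in> T1"
    using assms by (simp add: spokes_def)
  moreover have "bare E U T1 \<subseteq> T1 - {u}"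
    using assms by (auto simp: bare_def rev_image_eqI)
  ultimately show ?thesis
    using card_mono[of "T1 - {u}" "bare E U T1"] finite_T card_T1 by simp
qed

text \<open>Serves the case of triangles linked through an outer vertex, which supplies one spoke
  beyond \<open>card U\<close>. There are at most \<open>?s1 * ?s2\<close> small matchings and at
  least \<open>?k1 * ?s2 + ?k2 * ?s1\<close> large ones, where \<open>?s1\<close> and
  \<open>?s2\<close> are at most 2.\<close>

lemma surplus_spoke:
  assumes "(u1, v1) \<in> spokes E U T1" "(u2, v2) \<in> spokes E U T2"
    and "card U + 1 \<le> card (spokes E U T1) + card (spokes E U T2)"
    and "small_matchings \<noteq> {}"
  shows "(3 * card U + 1) * card small_matchings < 6 * card large_matchings"
proof -
  let ?s1 = "card (bare E U T1)" and ?s2 = "card (bare E U T2)"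
  let ?k1 = "card (spokes E U T1)" and ?k2 = "card (spokes E U T2)"
  have A: "card small_matchings \<le> ?s1 * ?s2"
    by (rule card_small_matchings_le)
  have pos: "0 < card small_matchings"
    using assms(4) finite_matchings(2) by (simp add: card_gt_0_iff)
  have s: "?s1 \<le> 2" "?s2 \<le> 2"
    using card_bare[OF assms(1)] linked_triangles.card_bare[OF swap assms(2)] .
  have B: "?k1 * ?s2 + ?k2 * ?s1 \<le> card large_matchings"
    using card_large_matchings[of "{}"] by simp
  have "(3 * card U + 1) * card small_matchings \<le> (3 * card U + 1) * (?s1 * ?s2)"
    using A by (rule mult_left_mono) simp
  \<comment> \<open>Strict because \<open>3 * card U + 1\<close> is below
    \<open>3 * (card U + 1)\<close> and the product of the bare counts is positive, being at least
    the number of small matchings.\<close>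
  also have "\<dots> < 3 * (?k1 + ?k2) * (?s1 * ?s2)"
    using assms(3) less_le_trans[OF pos A] by (intro mult_strict_right_mono) auto
  also have "\<dots> = 3 * (?s1 * (?k1 * ?s2) + ?s2 * (?k2 * ?s1))"
    by (simp add: algebra_simps)
  also have "\<dots> \<le> 3 * (2 * (?k1 * ?s2) + 2 * (?k2 * ?s1))"
    using s by (intro mult_left_mono add_mono mult_right_mono) auto
  also have "\<dots> \<le> 6 * card large_matchings"
    using B by simp
  finally show ?thesis .
qed

text \<open>Without a surplus spoke the estimate falls short by up to \<open>?s1 * ?s2\<close>, at
  most 4. One more large matching contributes 6: two spokes, disjoint since \<open>v1\<close> and
  \<open>v2\<close> differ, together with the triangle edges opposite to them. It contains edges
  opposite spoke ends in both triangles, so it lies in neither family.\<close>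

lemma spokes_on_both:
  assumes u1: "(u1, v1) \<in> spokes E U T1" and u2: "(u2, v2) \<in> spokes E U T2" and "v1 \<noteq> v2"
    and k: "card U \<le> card (spokes E U T1) + card (spokes E U T2)"
  shows "(3 * card U + 1) * card small_matchings < 6 * card large_matchings"
proof -
  interpret swapped: linked_triangles E T2 T1 U
    by (rule swap)
  let ?s1 = "card (bare E U T1)" and ?s2 = "card (bare E U T2)"
  let ?k1 = "card (spokes E U T1)" and ?k2 = "card (spokes E U T2)"
  have mem: "u1 \<in> T1" "v1 \<in> U" "u2 \<in> T2" "v2 \<in> U" "{u1, v1} \<in> E" "{u2, v2} \<in> E"
    using u1 u2 by (auto simp: spokes_def)
  then have "{u1, v1} \<inter> (T1 - {u1}) = {}" "{u1, v1} \<inter> {u2, v2} = {}" "{u1, v1} \<inter> (T2 - {u2}) = {}"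
    "(T1 - {u1}) \<inter> {u2, v2} = {}" "(T1 - {u1}) \<inter> (T2 - {u2}) = {}" "{u2, v2} \<inter> (T2 - {u2}) = {}"
    using disj \<open>v1 \<noteq> v2\<close> by auto
  then have "is_matching E {{u1, v1}, T1 - {u1}, {u2, v2}, T2 - {u2}}"
    using mem T1_edge T2_edge
    by (intro is_matching_insert is_matching_empty) auto
  from maximal_matching_extends[OF finite_E this]
  obtain M where M: "is_maximal_matching E M" "{{u1, v1}, T1 - {u1}, {u2, v2}, T2 - {u2}} \<subseteq> M" .
  have "{u1, v1} \<noteq> T1 - {u1}" "{u1, v1} \<noteq> T2 - {u2}"
    using mem disj by auto
  moreover have "T1 - {u1} \<noteq> T2 - {u2}"
    using triangle_edge_nonempty[OF mem(1)] disj(1) by blast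
  ultimately have "3 \<le> card M"
    using M by (intro card_ge_3[of M "{u1, v1}" "T1 - {u1}" "T2 - {u2}"]) auto
  with M have "M \<in> large_matchings"
    by (simp add: large_matchings_def)
  moreover have "M \<notin> spoke_matchings T1 T2" "M \<notin> spoke_matchings T2 T1"
    using M(2) spoke_matching_avoids[of M u2] swapped.spoke_matching_avoids[of M u1]
      imageI[OF u1, of fst] imageI[OF u2, of fst] by auto
  ultimately have B: "?k1 * ?s2 + ?k2 * ?s1 + 1 \<le> card large_matchings"
    using card_large_matchings[of "{M}"] by simp
  have s: "?s1 \<le> 2" "?s2 \<le> 2"
    using card_bare[OF u1] swapped.card_bare[OF u2] .
  have "(3 * card U + 1) * card small_matchings \<le> (3 * (?k1 + ?k2) + 1) * (?s1 * ?s2)"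
    using k card_small_matchings_le by (intro mult_mono) auto
  also have "\<dots> = 3 * (?s1 * (?k1 * ?s2) + ?s2 * (?k2 * ?s1)) + ?s1 * ?s2"
    by (simp add: algebra_simps)
  also have "\<dots> \<le> 3 * (2 * (?k1 * ?s2) + 2 * (?k2 * ?s1)) + 2 * 2"
    using s by (intro mult_left_mono add_mono mult_right_mono mult_mono) auto
  also have "\<dots> < 6 * card large_matchings"
    using B by simp
  finally show ?thesis .
qed

text \<open>All of \<open>T2\<close> is bare here, so there are at least three large matchings for
  each spoke. The condition that \<open>u\<close> differs from \<open>x\<close> excludes the
  extremal graph: it allows a further large matching using both the spoke \<open>{u, v}\<close> and
  the link \<open>{x, y}\<close>. With at most five small matchings, the claim reduces to
  \<open>5 * (3 * k + 1) < 6 * (3 * k + 1)\<close> for \<open>k = card U\<close>.\<close>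

lemma spokes_on_one:
  assumes uv: "(u, v) \<in> spokes E U T1" and none: "spokes E U T2 = {}"
    and xy: "x \<in> T1" "y \<in> T2" "{x, y} \<in> E" and "u \<noteq> x"
    and k: "card U \<le> card (spokes E U T1)"
  shows "(3 * card U + 1) * card small_matchings < 6 * card large_matchings"
proof -
  have mem: "u \<in> T1" "v \<in> U" "{u, v} \<in> E"
    using uv by (auto simp: spokes_def)
  then have "{u, v} \<inter> {x, y} = {}" "{u, v} \<inter> (T2 - {y}) = {}" "{x, y} \<inter> (T2 - {y}) = {}"
    using xy disj \<open>u \<noteq> x\<close> by auto
  then have "is_matching E {{u, v}, {x, y}, T2 - {y}}"
    using mem xy T2_edge
    by (intro is_matching_insert is_matching_empty) auto
  from maximal_matching_extends[OF finite_E this]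
  obtain M where M: "is_maximal_matching E M" "{{u, v}, {x, y}, T2 - {y}} \<subseteq> M" .
  have bare2: "bare E U T2 = T2"
    using none by (simp add: bare_def)
  have "{u, v} \<noteq> {x, y}" "{u, v} \<noteq> T2 - {y}" "{x, y} \<noteq> T2 - {y}"
    using mem xy disj by (auto simp: doubleton_eq_iff)
  then have "M \<in> large_matchings"
    using M card_ge_3[OF M] by (simp add: large_matchings_def)
  moreover have "M \<notin> spoke_matchings T2 T1"
    by (simp add: spoke_matchings_def none)
  \<comment> \<open>A member of this family covers each vertex of \<open>T1\<close> by a spoke or by
    an edge of \<open>T1\<close>, while \<open>M\<close> covers \<open>x\<close> by the link to
    \<open>y\<close>, which lies in \<open>T2\<close>.\<close>
  moreover have "M \<notin> spoke_matchings T1 T2"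
  proof
    assume "M \<in> spoke_matchings T1 T2"
    then obtain u' v' where u': "(u', v') \<in> spokes E U T1" "{u', v'} \<in> M" "T1 - {u'} \<in> M"
      by (auto simp: spoke_matchings_def)
    have Mm: "is_matching E M"
      using M maximal_matchingD by blast
    have xyM: "{x, y} \<in> M"
      using M by simp
    show False
    proof (cases "x = u'")
      case True
      then have "y \<in> {u', v'}"
        using matching_edges_eq[OF Mm u'(2) xyM, of x] by simp
      then show False
        using u'(1) xy disj by (auto simp: spokes_def)
    next
      case False
      then have "y \<in> T1"
        using matching_edges_eq[OF Mm u'(3) xyM, of x] xy by auto
      then show False
        using xy disj by auto
    qed
  qed
  ultimately have B: "card (spokes E U T1) * 3 + 1 \<le> card large_matchings"
    using card_large_matchings[of "{M}"] bare2 card_T2 by simp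
  \<comment> \<open>There are at most two bare vertices in \<open>T1\<close> and three in
    \<open>T2\<close>, giving six pairs. If \<open>x\<close> is bare, the adjacent pair
    \<open>(x, y)\<close> drops out; otherwise \<open>x\<close> and \<open>u\<close> both carry
    spokes and at most three pairs remain.\<close>
  have "card small_matchings \<le> 5"
  proof (cases "x \<in> bare E U T1")
    case True
    have "card small_matchings \<le> card (bare E U T1 \<times> T2 - {(x, y)})"
      using bare2 xy finite_bare finite_T by (intro card_small_matchings) auto
    also have "\<dots> = card (bare E U T1) * 3 - 1"
      using True xy finite_bare finite_T card_T2 by (simp add: card_cartesian_product)
    also have "\<dots> \<le> 5"
      using card_bare[OF uv] by simp
    finally show ?thesis .
  next
    case False
    have "bare E U T1 \<subseteq> T1 - {x, u}"
      using False uv by (auto simp: bare_def rev_image_eqI)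
    then have "card (bare E U T1) \<le> card (T1 - {x, u})"
      using finite_T by (intro card_mono) auto
    also have "\<dots> = 1"
      using xy mem \<open>u \<noteq> x\<close> card_T1 finite_T by (subst card_Diff_subset) auto
    finally show ?thesis
      using card_small_matchings_le bare2 card_T2 by simp
  qed
  then have "(3 * card U + 1) * card small_matchings \<le> (3 * card U + 1) * 5"
    by (intro mult_left_mono) auto
  then show ?thesis
    using B k by simp
qed

end

section \<open>From counts of matchings to averages\<close>

lemma avm_gt:
  assumes fin: "finite E" and ge: "\<And>M. is_maximal_matching E M \<Longrightarrow> 2 \<le> card M"
    and bound: "card {M. is_maximal_matching E M \<and> card M = 2} * m <
      6 * card {M. is_maximal_matching E M}"
    and m: "0 < m"
  shows "3 - 6 / real m < avm E"
proof -
  let ?N = "{M. is_maximal_matching E M}"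
  let ?A = "{M. is_maximal_matching E M \<and> card M = 2}"
  have finN: "finite ?N"
    by (rule finite_maximal_matchings[OF fin])
  have pos: "0 < real (card ?N)"
    using bound by simp
  \<comment> \<open>Each maximal matching is counted with weight 3, lowered to 2 when it has two
    edges; all others have at least three edges.\<close>
  have "3 * real (card ?N) - real (card ?A) = (\<Sum>M\<in>?N. 3 - (if card M = 2 then 1 else 0))"
    using finN by (simp add: sum_subtractf sum.If_cases Collect_conj_eq)
  also have "\<dots> \<le> (\<Sum>M\<in>?N. real (card M))"
    using ge by (intro sum_mono) (force simp: le_eq_less_or_eq)
  finally have sum: "3 * real (card ?N) - real (card ?A) \<le> (\<Sum>M\<in>?N. real (card M))" .
  have "real (card ?A) * real m < 6 * real (card ?N)"
    using bound by (metis of_nat_less_iff of_nat_mult of_nat_numeral)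
  then have "real (card ?A) / real (card ?N) < 6 / real m"
    using pos m by (simp add: field_simps)
  then have "3 - 6 / real m < (3 * real (card ?N) - real (card ?A)) / real (card ?N)"
    using pos by (simp add: diff_divide_distrib)
  also have "\<dots> \<le> avm E"
    unfolding avm_def using sum pos by (intro divide_right_mono) auto
  finally show ?thesis .
qed

text \<open>The counterpart for the extremal graph: the sizes add up to at most
  \<open>3 * N - 6\<close>, where \<open>N\<close> is the number of maximal matchings. Since
  \<open>3 - 6 / N\<close> increases with \<open>N\<close>, an upper bound \<open>m\<close> on that
  number suffices.\<close>

lemma avm_le:
  assumes fin: "finite E" and le: "\<And>M. is_maximal_matching E M \<Longrightarrow> card M \<le> 3"
    and A: "A \<subseteq> {M. is_maximal_matching E M}" "card A = 6" "\<And>M. M \<in> A \<Longrightarrow> card M \<le> 2"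
    and m: "card {M. is_maximal_matching E M} \<le> m"
  shows "avm E \<le> 3 - 6 / real m"
proof -
  let ?N = "{M. is_maximal_matching E M}"
  have finN: "finite ?N"
    by (rule finite_maximal_matchings[OF fin])
  then have pos: "0 < card ?N"
    using card_mono[OF _ A(1)] A(2) by simp
  have inter: "?N \<inter> A = A"
    using A(1) by auto
  have "(\<Sum>M\<in>?N. real (card M)) \<le> (\<Sum>M\<in>?N. 3 - (if M \<in> A then 1 else 0))"
    using le A(3) by (intro sum_mono) force
  also have "\<dots> = 3 * real (card ?N) - 6"
    using finN A(2) inter by (simp add: sum_subtractf sum.If_cases)
  finally have "avm E \<le> (3 * real (card ?N) - 6) / real (card ?N)"
    unfolding avm_def by (rule divide_right_mono) simp
  also have "\<dots> = 3 - 6 / real (card ?N)"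
    using pos by (simp add: field_simps)
  also have "\<dots> \<le> 3 - 6 / real m"
    using m pos by (intro diff_left_mono divide_left_mono) auto
  finally show ?thesis .
qed

section \<open>The maximal matchings of the extremal graph\<close>

definition T_triangle :: "nat set set" where
  "T_triangle = {{3, 4}, {4, 5}, {3, 5}}"

lemma T_triangle_intersect: "s \<in> T_triangle \<Longrightarrow> t \<in> T_triangle \<Longrightarrow> s \<inter> t \<noteq> {}"
  unfolding T_triangle_def by (elim insertE emptyE) simp_all

lemma T_triangle_mem: "t \<in> T_triangle \<Longrightarrow> v \<in> t \<Longrightarrow> v = 3 \<or> v = 4 \<or> v = 5"
  by (auto simp: T_triangle_def)

lemma T_edges_cases:
  assumes "f \<in> T_edges n"
  obtains "2 \<in> f" | "f = {0, 1}" | "f \<in> T_triangle"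
  using assms unfolding T_edges_def T_triangle_def by (elim UnE insertE emptyE) auto

lemma T_edges_with_2:
  assumes "e \<in> T_edges n" "2 \<in> e"
  obtains j where "6 \<le> j" "j < n" "e = {2, j}" | i where "i \<in> {0, 1}" "e = {2, i}" | "e = {2, 3}"
  using assms unfolding T_edges_def by (elim UnE insertE emptyE) (auto simp: insert_commute)

lemma finite_T_edges: "finite (T_edges n)"
proof -
  have "{{2, k} |k. 6 \<le> k \<and> k < n} = (\<lambda>k. {2, k}) ` {6..<n}"
    by auto
  then show ?thesis
    by (simp add: T_edges_def)
qed

lemma empty_not_T_edge: "{} \<notin> T_edges n"
  by (auto simp: T_edges_def)

text \<open>Since \<open>n\<close> is at least 7, the leaf 6 exists, and covering its edge forces
  vertex 2 to be covered by some \<open>e\<close>. Every edge avoiding 2 is \<open>{0, 1}\<close> or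
  belongs to \<open>T_triangle\<close>. The cases are \<open>e\<close> pendant, \<open>e\<close> in
  the first triangle, and \<open>e\<close> the bridge; what remains is forced up to the choice of
  the edge in \<open>T_triangle\<close>.\<close>

lemma T_maximal_matching_cases:
  assumes n: "7 \<le> n" and M: "is_maximal_matching (T_edges n) M"
  obtains j t where "j \<in> {6..<n}" "t \<in> T_triangle" "M = {{2, j}, {0, 1}, t}"
    | i t where "i \<in> {0, 1}" "t \<in> T_triangle" "M = {{2, i}, t}"
    | "M = {{2, 3}, {0, 1}, {4, 5}}"
proof -
  have match: "is_matching (T_edges n) M" and cover: "\<And>d. d \<in> T_edges n \<Longrightarrow> d \<inter> \<Union>M \<noteq> {}"
    using M maximal_matching_iff[OF empty_not_T_edge] by simp_all
  have sub: "f \<in> T_edges n" if "f \<in> M" for f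
    using match that by (auto simp: is_matching_def)
  have "{2, 6} \<in> T_edges n"
    using n unfolding T_edges_def by (intro UnI2 CollectI exI[of _ 6]) simp
  from cover[OF this] obtain e where e: "e \<in> M" "2 \<in> e \<or> 6 \<in> e"
    by auto
  have e2: "2 \<in> e"
    using sub[OF e(1)] e(2) by (cases rule: T_edges_cases) (auto dest: T_triangle_mem)
  have others: "f = {0, 1} \<or> f \<in> T_triangle" if "f \<in> M" "f \<noteq> e" for f
    using sub[OF that(1)]
  proof (cases rule: T_edges_cases)
    case 1
    then show ?thesis
      using matching_edges_eq[OF match that(1) e(1), of 2] e2 that(2) by simp
  qed auto
  have tri_E: "s \<in> T_edges n" if "s \<in> T_triangle" for s
    using that unfolding T_triangle_def by (elim insertE emptyE) (simp_all add: T_edges_def)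
  have E01: "{0, 1} \<in> T_edges n"
    by (simp add: T_edges_def)
  have tri_unique: "s = t" if "s \<in> M" "t \<in> M" "s \<in> T_triangle" "t \<in> T_triangle" for s t
    using matching_edges_eq[OF match that(1,2)] T_triangle_intersect[OF that(3,4)] by blast
  have in01: "{0, 1} \<in> M" if e01: "e \<inter> {0, 1} = {}"
  proof -
    have "{0, 1} \<inter> \<Union>M \<noteq> {}"
      by (rule cover[OF E01])
    then obtain f where f: "f \<in> M" "0 \<in> f \<or> 1 \<in> f"
      by auto
    then have "f \<noteq> e"
      using e01 by auto
    moreover have "f \<notin> T_triangle"
      using f(2) T_triangle_mem[of f 0] T_triangle_mem[of f 1] by auto
    ultimately show ?thesis
      using others[OF f(1)] f(1) by simp
  qed
  have tri: "\<exists>t\<in>T_triangle. t \<in> M" if s: "s \<in> T_triangle" "e \<inter> s = {}" for s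
  proof -
    have "s \<inter> \<Union>M \<noteq> {}"
      by (rule cover[OF tri_E[OF s(1)]])
    then obtain f v where f: "f \<in> M" "v \<in> f" "v \<in> s"
      by auto
    then have "f \<noteq> e"
      using s(2) by auto
    moreover have "v \<notin> {0, 1}"
      using T_triangle_mem[OF s(1) f(3)] by auto
    ultimately show ?thesis
      using others[OF f(1)] f(1,2) by blast
  qed
  \<comment> \<open>Instances of \<open>s\<close> for \<open>tri\<close>: \<open>{3, 4}\<close> when
    \<open>e\<close> avoids the second triangle, and \<open>{4, 5}\<close> for the bridge, which
    meets \<open>{3, 4}\<close>.\<close>
  have in34: "{3, 4} \<in> T_triangle" and in45: "{4, 5} \<in> T_triangle"
    by (simp_all add: T_triangle_def)
  have rest: "f \<in> {e, {0, 1}, t}" if "t \<in> T_triangle" "t \<in> M" "f \<in> M" for f t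
  proof (cases "f = e \<or> f = {0, 1}")
    case False
    then have "f \<in> T_triangle"
      using others[OF that(3)] by simp
    then show ?thesis
      using tri_unique[OF that(3,2) _ that(1)] by simp
  qed auto
  show thesis
    using sub[OF e(1)] e2
  proof (cases rule: T_edges_with_2)
    case (1 j)
    have "{0, 1} \<in> M"
      using 1 by (intro in01) auto
    moreover obtain t where t: "t \<in> T_triangle" "t \<in> M"
      using tri[OF in34] 1 by auto
    ultimately have "{e, {0, 1}, t} \<subseteq> M"
      using e(1) by simp
    moreover have "M \<subseteq> {e, {0, 1}, t}"
      using rest[OF t] by (rule subsetI)
    ultimately have "M = {{2, j}, {0, 1}, t}"
      using 1(3) by (simp add: equalityI)
    then show thesis
      using that(1)[of j t] 1 t by simp
  next
    case (2 i)
    obtain t where t: "t \<in> T_triangle" "t \<in> M"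
      using tri[OF in34] 2 by auto
    have "{0, 1} \<notin> M"
    proof
      assume "{0, 1} \<in> M"
      then have "e = {0, 1}"
        using matching_edges_eq[OF match e(1), of "{0, 1}" i] 2 by auto
      then show False
        using e2 by simp
    qed
    then have "f \<in> {e, t}" if "f \<in> M" for f
      using rest[OF t that] that by (cases "f = {0, 1}") simp_all
    then have "M \<subseteq> {e, t}"
      by (rule subsetI)
    moreover have "{e, t} \<subseteq> M"
      using e(1) t(2) by simp
    ultimately have "M = {{2, i}, t}"
      using 2(2) by (simp add: equalityI)
    then show thesis
      using that(2)[of i t] 2 t by simp
  next
    case 3
    have "{0, 1} \<in> M"
      using 3 by (intro in01) auto
    obtain t where t: "t \<in> T_triangle" "t \<in> M"
      using tri[OF in45] 3 by auto
    have "3 \<notin> t"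
    proof
      assume "3 \<in> t"
      then have "t = {2, 3}"
        using matching_edges_eq[OF match t(2) e(1), of 3] 3 by auto
      then show False
        using T_triangle_mem[OF t(1), of 2] by simp
    qed
    then have "t = {4, 5}"
      using t(1) by (auto simp: T_triangle_def)
    moreover have "M \<subseteq> {e, {0, 1}, t}"
      using rest[OF t] by (rule subsetI)
    moreover have "{e, {0, 1}, t} \<subseteq> M"
      using e(1) t(2) \<open>{0, 1} \<in> M\<close> by simp
    ultimately have "M = {{2, 3}, {0, 1}, {4, 5}}"
      using 3 by (simp add: equalityI)
    then show thesis
      by (rule that(3))
  qed
qed

lemma T_small_maximal_matching:
  assumes "i \<in> {0, 1}" "t \<in> T_triangle"
  shows "is_maximal_matching (T_edges n) {{2, i}, t}"
proof -
  have "{2, i} \<in> T_edges n"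
    using assms(1) by (elim insertE emptyE) (simp_all add: T_edges_def insert_commute)
  moreover have "t \<in> T_edges n"
    using assms(2) unfolding T_triangle_def by (elim insertE emptyE) (simp_all add: T_edges_def)
  moreover have "{2, i} \<inter> t = {}"
    using assms(1) T_triangle_mem[OF assms(2), of 2] T_triangle_mem[OF assms(2), of i] by auto
  ultimately have "is_matching (T_edges n) {{2, i}, t}"
    by (intro is_matching_insert is_matching_empty) simp_all
  moreover have "d \<inter> \<Union>{{2, i}, t} \<noteq> {}" if "d \<in> T_edges n" for d
    using that
  proof (cases rule: T_edges_cases)
    case 3
    then show ?thesis
      using T_triangle_intersect[OF _ assms(2)] by blast
  qed (use assms in auto)
  ultimately show ?thesis
    unfolding maximal_matching_iff[OF empty_not_T_edge] by blast
qed

lemma card_T_triangle: "card T_triangle = 3"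
  by (simp add: T_triangle_def doubleton_eq_iff)

text \<open>The number \<open>3 * n - 11\<close> is \<open>3 * (n - 6) + 6 + 1\<close>: three
  matchings for each leaf, six with two edges, and one using the bridge.\<close>

lemma avm_T_edges_le:
  assumes n: "7 \<le> n"
  shows "avm (T_edges n) \<le> 3 - 6 / real (3 * n - 11)"
proof (rule avm_le[OF finite_T_edges])
  let ?P = "(\<lambda>(j, t). {{2, j}, {0, 1}, t}) ` ({6..<n} \<times> T_triangle)"
  let ?A = "(\<lambda>(i, t). {{2, i}, t}) ` ({0, 1} \<times> T_triangle)"
  have card_le: "card {a, b, c} \<le> 3" "card {a, b} \<le> 2" for a b c :: "nat set"
    by (simp_all add: card_insert_if)
  show "card M \<le> 3" if "is_maximal_matching (T_edges n) M" for M
    using n that by (cases rule: T_maximal_matching_cases)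
      (simp_all only: card_le order_trans[OF card_le(2), of 3])
  show "?A \<subseteq> {M. is_maximal_matching (T_edges n) M}"
    by (rule image_subsetI) (simp only: case_prod_beta mem_Collect_eq mem_Times_iff T_small_maximal_matching)
  have "inj_on (\<lambda>(i, t). {{2, i}, t}) ({0, 1} \<times> T_triangle)"
  proof (rule inj_onI)
    fix p q
    assume p: "p \<in> {0, 1} \<times> T_triangle" and q: "q \<in> {0, 1} \<times> T_triangle"
      and eq: "(\<lambda>(i, t). {{2, i}, t}) p = (\<lambda>(i, t). {{2, i}, t}) q"
    obtain i t j s where pq: "p = (i, t)" "q = (j, s)"
      by (metis prod.exhaust)
    have "2 \<notin> t" "2 \<notin> s"
      using p q pq T_triangle_mem[of t 2] T_triangle_mem[of s 2] by auto
    moreover have "{{2, i}, t} = {{2, j}, s}"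
      using eq pq by simp
    ultimately have "{2, i} = {2, j}" "t = s"
      by (metis doubleton_eq_iff insertI1)+
    then show "p = q"
      using pq by (auto simp: doubleton_eq_iff)
  qed
  then have "card ?A = card ({0, 1::nat} \<times> T_triangle)"
    by (rule card_image)
  also have "\<dots> = 6"
    unfolding card_cartesian_product card_T_triangle by simp
  finally show cardA: "card ?A = 6" .
  show "card M \<le> 2" if "M \<in> ?A" for M
    using that by (elim imageE) (simp only: case_prod_beta card_le)
  have fin: "finite ?P" "finite ?A"
    by (simp_all add: T_triangle_def)
  have "{M. is_maximal_matching (T_edges n) M} \<subseteq> ?P \<union> ?A \<union> {{{2, 3}, {0, 1}, {4, 5}}}"
  proof
    fix M
    assume "M \<in> {M. is_maximal_matching (T_edges n) M}"
    then have "is_maximal_matching (T_edges n) M"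
      by simp
    with n show "M \<in> ?P \<union> ?A \<union> {{{2, 3}, {0, 1}, {4, 5}}}"
    proof (cases rule: T_maximal_matching_cases)
      case (1 j t)
      then have "M \<in> ?P"
        by (intro image_eqI[of _ _ "(j, t)"]) simp_all
      then show ?thesis
        by blast
    next
      case (2 i t)
      then have "M \<in> ?A"
        by (intro image_eqI[of _ _ "(i, t)"]) simp_all
      then show ?thesis
        by blast
    qed blast
  qed
  then have "card {M. is_maximal_matching (T_edges n) M} \<le> card (?P \<union> ?A \<union> {{{2, 3}, {0, 1}, {4, 5}}})"
    using fin by (intro card_mono) auto
  also have "\<dots> \<le> card ?P + card ?A + 1"
    by (intro order_trans[OF card_Un_le] add_mono) auto
  also have "card ?P \<le> card ({6..<n} \<times> T_triangle)"
    by (rule card_image_le) (simp add: T_triangle_def)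
  also have "\<dots> = (n - 6) * 3"
    unfolding card_cartesian_product card_T_triangle by simp
  finally show "card {M. is_maximal_matching (T_edges n) M} \<le> 3 * n - 11"
    using cardA n by linarith
qed

section \<open>Recognizing the extremal graph\<close>

lemma card_3_removals:
  assumes "card T = 3" "x \<in> T"
  obtains a b where "T = {x, a, b}" "a \<noteq> b" "a \<noteq> x" "b \<noteq> x"
    "(\<lambda>w. T - {w}) ` T = {{a, b}, {a, x}, {b, x}}"
proof -
  have "card (T - {x}) = 2"
    using assms by simp
  then obtain a b where ab: "T - {x} = {a, b}" "a \<noteq> b"
    by (auto simp: card_2_iff)
  then have T: "T = {x, a, b}"
    using assms(2) by (metis insert_Diff)
  have ne: "a \<noteq> x" "b \<noteq> x"
    using ab(1) by auto
  have "T - {x} = {a, b}" "T - {a} = {b, x}" "T - {b} = {a, x}"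
    using ab T ne by auto
  then have "(\<lambda>w. T - {w}) ` T = {{a, b}, {a, x}, {b, x}}"
    unfolding T by (simp add: insert_commute)
  then show thesis
    using that T ab(2) ne by simp
qed

lemma graph_iso_T_edges:
  assumes T: "card T1 = 3" "card T2 = 3" "x \<in> T1" "y \<in> T2"
    and V: "V = T1 \<union> T2 \<union> U" "T1 \<inter> T2 = {}" "T1 \<inter> U = {}" "T2 \<inter> U = {}" "finite U" "card U + 6 = n"
    and E: "E = (\<lambda>w. T1 - {w}) ` T1 \<union> (\<lambda>w. T2 - {w}) ` T2 \<union> {{x, y}} \<union> (\<lambda>v. {x, v}) ` U"
  shows "graph_iso V E {0..<n} (T_edges n)"
proof -
  obtain a b where ab: "T1 = {x, a, b}" "a \<noteq> b" "a \<noteq> x" "b \<noteq> x"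
    "(\<lambda>w. T1 - {w}) ` T1 = {{a, b}, {a, x}, {b, x}}"
    using card_3_removals[OF T(1,3)] .
  obtain p q where pq: "T2 = {y, p, q}" "p \<noteq> q" "p \<noteq> y" "q \<noteq> y"
    "(\<lambda>w. T2 - {w}) ` T2 = {{p, q}, {p, y}, {q, y}}"
    using card_3_removals[OF T(2,4)] .
  have "card U = card {6..<n}"
    using V by simp
  then obtain g where g: "bij_betw g U {6..<n}"
    using V(5) by (metis finite_atLeastLessThan finite_same_card_bij)
  \<comment> \<open>Vertex \<open>x\<close>, where all outer vertices are attached, takes the place
    of 2, and \<open>y\<close> at the other end of the bridge that of 3. The outer vertices go to
    the leaves by an arbitrary bijection.\<close>
  define f where "f = g(a := 0, b := 1, x := 2, y := 3, p := 4, q := 5)"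
  have ne: "x \<noteq> y" "x \<noteq> p" "x \<noteq> q" "a \<noteq> y" "a \<noteq> p" "a \<noteq> q" "b \<noteq> y" "b \<noteq> p" "b \<noteq> q"
    using V(2) ab(1) pq(1) by auto
  have f: "f a = 0" "f b = 1" "f x = 2" "f y = 3" "f p = 4" "f q = 5"
    using ne ab(2-4) pq(2-4) by (auto simp: f_def)
  have fU: "f v = g v" if "v \<in> U" for v
    using that V(3,4) ab(1) pq(1) by (auto simp: f_def)
  have "bij_betw f (T1 \<union> T2) {0..<6}"
  proof -
    have "inj_on f (T1 \<union> T2)"
      unfolding ab(1) pq(1) inj_on_def by (simp add: f)
    moreover have "f ` (T1 \<union> T2) = {0..<6}"
      unfolding ab(1) pq(1) by (auto simp: f)
    ultimately show ?thesis
      by (simp add: bij_betw_def)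
  qed
  moreover have "bij_betw f U {6..<n}"
    using g bij_betw_cong[of U f g] fU by blast
  ultimately have "bij_betw f (T1 \<union> T2 \<union> U) ({0..<6} \<union> {6..<n})"
    by (rule bij_betw_combine) auto
  moreover have "{0..<6} \<union> {6..<n} = {0..<n}"
    using V(6) by auto
  ultimately have "bij_betw f V {0..<n}"
    using V(1) by simp
  moreover have "(\<lambda>e. f ` e) ` E = T_edges n"
  proof -
    have "(\<lambda>e. f ` e) ` (\<lambda>v. {x, v}) ` U = (\<lambda>k. {2, k}) ` g ` U"
      by (simp add: image_image f fU cong: image_cong)
    also have "\<dots> = {{2, k} |k. 6 \<le> k \<and> k < n}"
      using g by (auto simp: bij_betw_def)
    finally have "(\<lambda>e. f ` e) ` (\<lambda>v. {x, v}) ` U = {{2, k} |k. 6 \<le> k \<and> k < n}" .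
    moreover have "(\<lambda>e. f ` e) ` ({{a, b}, {a, x}, {b, x}} \<union> {{p, q}, {p, y}, {q, y}} \<union> {{x, y}})
        = {{0,1},{1,2},{0,2},{3,4},{4,5},{3,5},{2,3}}"
      by (simp add: f insert_commute)
    ultimately show ?thesis
      unfolding E ab(5) pq(5) T_edges_def by (metis image_Un)
  qed
  ultimately show ?thesis
    unfolding graph_iso_def by blast
qed

lemma card_2_subset_3:
  assumes "card T = 3" "e \<subseteq> T" "card e = 2"
  obtains w where "w \<in> T" "e = T - {w}"
proof -
  have fin: "finite T" "finite e"
    using assms by (auto intro: card_ge_0_finite)
  then have "card (T - e) = 1"
    using assms by (simp add: card_Diff_subset)
  then obtain w where w: "T - e = {w}"
    by (auto simp: card_1_singleton_iff)
  then have "w \<in> T" "e = T - {w}"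
    using assms(2) by auto
  then show thesis
    by (rule that)
qed

section \<open>Comparison of an arbitrary graph with the extremal one\<close>

context disjoint_cycles
begin

text \<open>In the decomposition of \<open>E\<close>, the edges of the other cycle, the chosen edges
  at outer vertices and the linking edge \<open>g\<close> all have an end off the first cycle, so
  this cycle has no chord.\<close>

lemma edge_in_cycle1:
  assumes M: "is_maximal_matching E M" "card M = 2" and e: "e \<in> E" "e \<subseteq> set c1"
  shows "e \<in> cycle_edges c1"
proof -
  obtain h g where
    Eeq: "E = cycle_edges c1 \<union> cycle_edges c2 \<union> (\<lambda>v. {v, h v}) ` (V - X) \<union> {g}"
    and g: "(\<exists>x\<in>set c1. \<exists>y\<in>set c2. g = {x, y}) \<or>
      (\<exists>z\<in>V - X. h z \<in> set c1 \<and> (\<exists>y\<in>set c2. g = {z, y}) \<or>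
        h z \<in> set c2 \<and> (\<exists>x\<in>set c1. g = {z, x}))"
    by (rule small_matching_edges[OF M]) (rule that)
  have "e \<noteq> {}"
    using e(1) empty_not_edge by auto
  then have "e \<notin> cycle_edges c2"
    using e(2) disj cycle_edges_in_set[of e c2] by blast
  moreover have "e \<notin> (\<lambda>v. {v, h v}) ` (V - X)"
    using e(2) by auto
  moreover have "e \<noteq> g"
    using g e(2) disj by auto
  ultimately show ?thesis
    using e(1) Eeq by blast
qed

text \<open>Such an edge is neither a cycle edge nor incident to an outer vertex, which leaves only
  \<open>g\<close>.\<close>

lemma cross_edge_unique:
  assumes M: "is_maximal_matching E M" "card M = 2"
    and e: "e \<in> E" "e \<subseteq> X" "\<not> e \<subseteq> set c1" "\<not> e \<subseteq> set c2"
    and f: "f \<in> E" "f \<subseteq> X" "\<not> f \<subseteq> set c1" "\<not> f \<subseteq> set c2"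
  shows "e = f"
proof -
  obtain h g where Eeq: "E = cycle_edges c1 \<union> cycle_edges c2 \<union> (\<lambda>v. {v, h v}) ` (V - X) \<union> {g}"
    by (rule small_matching_edges[OF M]) (rule that)
  have "d = g" if d: "d \<in> E" "d \<subseteq> X" "\<not> d \<subseteq> set c1" "\<not> d \<subseteq> set c2" for d
  proof -
    have "d \<notin> cycle_edges c1" "d \<notin> cycle_edges c2"
      using d cycle_edges_in_set by auto
    moreover have "d \<notin> (\<lambda>v. {v, h v}) ` (V - X)"
      using d(2) by auto
    ultimately show ?thesis
      using d(1) Eeq by blast
  qed
  then show ?thesis
    using e f by metis
qed

text \<open>Only two vertices of the first cycle are covered, and \<open>e\<close> accounts for
  both. The disjoint edge \<open>f\<close> must then find its ends on the second cycle.\<close>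

lemma small_matching_partner:
  assumes M: "is_maximal_matching E M" "card M = 2" "M = {e, f}" "e \<noteq> f" and e: "e \<subseteq> set c1"
  shows "\<Union>M \<inter> set c1 = e" and "f \<subseteq> set c2"
proof -
  have eE: "e \<in> E"
    using maximal_matching_subset[OF M(1)] M(3) by simp
  have "e = \<Union>M \<inter> set c1"
    using small_matching_cover(1)[OF M(1,2)] card_edge[OF eE] M(3) e
    by (intro card_subset_eq) auto
  then show eq: "\<Union>M \<inter> set c1 = e"
    by simp
  have "e \<inter> f = {}"
    using M by (auto simp: is_maximal_matching_def is_matching_def)
  then have "f \<inter> set c1 = {}"
    using eq M(3) by auto
  then show "f \<subseteq> set c2"
    using small_matching_cover(3)[OF M(1,2)] M(3) by auto
qed

lemma small_matching_split:
  assumes M: "is_maximal_matching E M" "card M = 2"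
  obtains e f where "M = {e, f}" "e \<noteq> f" "e \<subseteq> set c1" "f \<subseteq> set c2"
proof -
  interpret swapped: disjoint_cycles V E c2 c1
    by (rule swap)
  obtain e f where ef: "M = {e, f}" "e \<noteq> f"
    using M(2) by (auto simp: card_2_iff)
  have fe: "M = {f, e}" "f \<noteq> e"
    using ef by auto
  have E: "e \<in> E" "f \<in> E"
    using maximal_matching_subset[OF M(1)] ef(1) by auto
  have X: "e \<subseteq> X" "f \<subseteq> X"
    using small_matching_cover(3)[OF M] ef(1) by auto
  \<comment> \<open>Otherwise both edges would run between the cycles and coincide.\<close>
  consider "e \<subseteq> set c1" | "e \<subseteq> set c2" | "f \<subseteq> set c1" | "f \<subseteq> set c2"
    using cross_edge_unique[OF M E(1) X(1) _ _ E(2) X(2)] ef(2) by blast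
  then show thesis
  proof cases
    case 1
    then show thesis
      using that[OF ef] small_matching_partner(2)[OF M ef] by simp
  next
    case 2
    then show thesis
      using that[OF fe] swapped.small_matching_partner(2)[OF M ef] by simp
  next
    case 3
    then show thesis
      using that[OF fe] small_matching_partner(2)[OF M fe] by simp
  next
    case 4
    then show thesis
      using that[OF ef] swapped.small_matching_partner(2)[OF M fe] by simp
  qed
qed

lemma cycle1_triangle:
  assumes M: "is_maximal_matching E M" "card M = 2"
  shows "card (set c1) = 3" and "w \<in> set c1 \<Longrightarrow> set c1 - {w} \<in> E"
proof -
  obtain e f where ef: "M = {e, f}" "e \<noteq> f" "e \<subseteq> set c1" "f \<subseteq> set c2"
    using small_matching_split[OF M] .
  have "e \<in> E"
    using maximal_matching_subset[OF M(1)] ef(1) by simp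
  then have "\<Union>M \<inter> set c1 \<in> cycle_edges c1"
    using edge_in_cycle1[OF M _ ef(3)] small_matching_partner(1)[OF M ef(1-3)] by simp
  from cycle_covered_by_edge[OF cycle1 maximal_matching_covers[OF M(1)] this]
  show "card (set c1) = 3" and "w \<in> set c1 \<Longrightarrow> set c1 - {w} \<in> E" .
qed

text \<open>A single two-edge maximal matching already makes both cycles triangles; splitting any
  other such \<open>M'\<close> then gives one edge in each.\<close>

lemma linked_triangles:
  assumes M: "is_maximal_matching E M" "card M = 2"
  shows "linked_triangles E (set c1) (set c2) (V - X)"
proof
  note tri1 = cycle1_triangle[OF M]
  note tri2 = disjoint_cycles.cycle1_triangle[OF swap M]
  show "card (set c1) = 3" "card (set c2) = 3"
    by (rule tri1 tri2)+
  show "set c1 - {w} \<in> E" if "w \<in> set c1" for w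
    using that by (rule tri1)
  show "set c2 - {w} \<in> E" if "w \<in> set c2" for w
    using that by (rule tri2)
  show "\<exists>w1\<in>set c1. \<exists>w2\<in>set c2. M' = {set c1 - {w1}, set c2 - {w2}}"
    if M': "is_maximal_matching E M'" "card M' = 2" for M'
  proof -
    obtain e f where ef: "M' = {e, f}" "e \<noteq> f" "e \<subseteq> set c1" "f \<subseteq> set c2"
      using small_matching_split[OF M'] .
    have E: "e \<in> E" "f \<in> E"
      using maximal_matching_subset[OF M'(1)] ef(1) by auto
    obtain w1 where "w1 \<in> set c1" "e = set c1 - {w1}"
      using card_2_subset_3[OF tri1(1) ef(3) card_edge[OF E(1)]] .
    moreover obtain w2 where "w2 \<in> set c2" "f = set c2 - {w2}"
      using card_2_subset_3[OF tri2(1) ef(4) card_edge[OF E(2)]] .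
    ultimately show ?thesis
      using ef(1) by blast
  qed
qed (use finite_E finite_V card_edge disj in auto)

lemma cycle1_edges_triangle:
  assumes M: "is_maximal_matching E M" "card M = 2"
  shows "cycle_edges c1 = (\<lambda>w. set c1 - {w}) ` set c1"
proof
  show "cycle_edges c1 \<subseteq> (\<lambda>w. set c1 - {w}) ` set c1"
  proof
    fix e
    assume e: "e \<in> cycle_edges c1"
    then have "e \<subseteq> set c1" "card e = 2"
      using cycle_edges_in_set cycle_edges_subset[OF cycle1] card_edge by auto
    then obtain w where "w \<in> set c1" "e = set c1 - {w}"
      using card_2_subset_3[OF cycle1_triangle(1)[OF M]] by metis
    then show "e \<in> (\<lambda>w. set c1 - {w}) ` set c1"
      by blast
  qed
  show "(\<lambda>w. set c1 - {w}) ` set c1 \<subseteq> cycle_edges c1"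
    using edge_in_cycle1[OF M] cycle1_triangle(2)[OF M] by blast
qed

text \<open>The split is on the linking edge \<open>g\<close>. If it joins the triangles directly,
  the position of the spokes decides which estimate applies; if it ends in an outer vertex, there is
  a surplus spoke.\<close>

lemma few_small_matchings:
  assumes n: "7 \<le> card V" and M: "is_maximal_matching E M" "card M = 2"
    and not_T: "\<not> graph_iso V E {0..<card V} (T_edges (card V))"
  shows "(3 * (card V - 6) + 1) * card {M. is_maximal_matching E M \<and> card M = 2} <
    6 * card {M. is_maximal_matching E M \<and> 3 \<le> card M}"
proof -
  define U where "U = V - X"
  interpret tri: linked_triangles E "set c1" "set c2" U
    unfolding U_def by (rule linked_triangles[OF M])
  interpret swapped: linked_triangles E "set c2" "set c1" U
    by (rule tri.swap)
  have A: "tri.small_matchings = {M. is_maximal_matching E M \<and> card M = 2}"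
    and A': "swapped.small_matchings = {M. is_maximal_matching E M \<and> card M = 2}"
    and B: "tri.large_matchings = {M. is_maximal_matching E M \<and> 3 \<le> card M}"
    and B': "swapped.large_matchings = {M. is_maximal_matching E M \<and> 3 \<le> card M}"
    by (simp_all add: tri.small_matchings_def swapped.small_matchings_def
        tri.large_matchings_def swapped.large_matchings_def)
  have VX: "V = set c1 \<union> set c2 \<union> U"
    using cycle1_subset cycle2_subset by (auto simp: U_def)
  have "card X = 6"
    using tri.card_T1 tri.card_T2 disj by (simp add: card_Un_disjoint)
  moreover have "card V = card X + card U"
    using VX finite_V by (metis Diff_disjoint U_def card_Un_disjoint finite_Un)
  ultimately have cardV: "card V = card U + 6"
    by simp
  obtain h g where hX: "\<forall>v\<in>V - X. h v \<in> X"
    and Eeq: "E = cycle_edges c1 \<union> cycle_edges c2 \<union> (\<lambda>v. {v, h v}) ` (V - X) \<union> {g}"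
    and g: "(\<exists>x\<in>set c1. \<exists>y\<in>set c2. g = {x, y}) \<or>
      (\<exists>z\<in>V - X. h z \<in> set c1 \<and> (\<exists>y\<in>set c2. g = {z, y}) \<or>
        h z \<in> set c2 \<and> (\<exists>x\<in>set c1. g = {z, x}))"
    by (rule small_matching_edges[OF M])
  let ?S1 = "spokes E U (set c1)" and ?S2 = "spokes E U (set c2)"
  \<comment> \<open>One spoke for each outer vertex, hence at least \<open>card U\<close> spokes in
    total.\<close>
  let ?H = "(\<lambda>v. (h v, v)) ` U"
  have cardH: "card ?H = card U"
    by (rule card_image) (auto intro: inj_onI)
  have hE: "{h v, v} \<in> E" if "v \<in> U" for v
    using that Eeq unfolding U_def by (auto simp: insert_commute)
  have H: "?H \<subseteq> ?S1 \<union> ?S2"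
    using hX hE by (auto simp: spokes_def U_def)
  have finS: "finite (?S1 \<union> ?S2)"
    using tri.finite_spokes by simp
  have "?S1 \<inter> ?S2 = {}"
    using disj by (auto simp: spokes_def)
  then have cardS: "card (?S1 \<union> ?S2) = card ?S1 + card ?S2"
    using tri.finite_spokes by (simp add: card_Un_disjoint)
  then have k: "card U \<le> card ?S1 + card ?S2"
    using card_mono[OF finS H] cardH by simp
  show ?thesis
  proof (cases "\<exists>x\<in>set c1. \<exists>y\<in>set c2. g = {x, y}")
    case True
    then obtain x y where xy: "x \<in> set c1" "y \<in> set c2" "g = {x, y}"
      by blast
    have xyE: "{x, y} \<in> E" "{y, x} \<in> E"
      using Eeq xy(3) by (auto simp: insert_commute)
    \<comment> \<open>With a direct link, an outer vertex has no spoke besides its chosen one, so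
      spokes at different triangle vertices have different outer ends.\<close>
    have spoke_h: "u = h v" if "{u, v} \<in> E" "v \<in> U" for u v
    proof -
      have "v \<notin> X"
        using that(2) by (simp add: U_def)
      then have "{u, v} \<notin> cycle_edges c1" "{u, v} \<notin> cycle_edges c2" "{u, v} \<noteq> g"
        using cycle_edges_in_set[of "{u, v}"] xy by (auto simp: doubleton_eq_iff)
      then have "{u, v} \<in> (\<lambda>v. {v, h v}) ` (V - X)"
        using that(1) Eeq by blast
      then obtain v' where "v' \<in> V - X" "{u, v} = {v', h v'}"
        by (rule imageE)
      then show ?thesis
        using that(2) bspec[OF hX, of v'] by (auto simp: doubleton_eq_iff U_def)
    qed
    \<comment> \<open>Stated for general \<open>T1\<close> and \<open>T2\<close>, because the leaves
      may hang on either of the two cycles.\<close>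
    have iso_graph: "graph_iso V E {0..<card V} (T_edges (card V))"
      if T: "card T1 = 3" "card T2 = 3" "a \<in> T1" "b \<in> T2" "g = {a, b}" "set c1 \<union> set c2 = T1 \<union> T2"
        "T1 \<inter> T2 = {}" "cycle_edges c1 \<union> cycle_edges c2 = (\<lambda>w. T1 - {w}) ` T1 \<union> (\<lambda>w. T2 - {w}) ` T2"
        and ha: "\<And>v. v \<in> U \<Longrightarrow> h v = a" for T1 T2 a b
    proof (rule graph_iso_T_edges[of T1 T2 a b V U])
      have "(\<lambda>v. {v, h v}) ` U = (\<lambda>v. {a, v}) ` U"
        using ha by (intro image_cong) (auto simp: insert_commute)
      then show "E = (\<lambda>w. T1 - {w}) ` T1 \<union> (\<lambda>w. T2 - {w}) ` T2 \<union> {{a, b}} \<union> (\<lambda>v. {a, v}) ` U"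
        using Eeq T(5,8) unfolding U_def by (simp add: Un_ac)
      show "T1 \<inter> U = {}" "T2 \<inter> U = {}"
        using T(6) unfolding U_def by auto
    qed (use T VX cardV tri.finite_U in auto)
    have cyc: "cycle_edges c1 = (\<lambda>w. set c1 - {w}) ` set c1"
      "cycle_edges c2 = (\<lambda>w. set c2 - {w}) ` set c2"
      using cycle1_edges_triangle[OF M] disjoint_cycles.cycle1_edges_triangle[OF swap M] .
    consider (both) "?S1 \<noteq> {}" "?S2 \<noteq> {}" | (one) "?S2 = {}" | (two) "?S1 = {}"
      by blast
    then show ?thesis
    proof cases
      case both
      then obtain u1 v1 u2 v2 where uv: "(u1, v1) \<in> ?S1" "(u2, v2) \<in> ?S2"
        by auto
      then have "u1 = h v1" "u2 = h v2" "u1 \<noteq> u2"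
        using disj by (auto simp: spokes_def intro: spoke_h)
      then have "v1 \<noteq> v2"
        by auto
      from tri.spokes_on_both[OF uv this k] show ?thesis
        using A B cardV by simp
    next
      case one
      \<comment> \<open>If every outer vertex hung on the end \<open>x\<close> of the link, the
        graph would be the extremal one.\<close>
      have "\<not> (\<forall>v\<in>U. h v = x)"
        using iso_graph[OF tri.card_T1 tri.card_T2 xy refl disj] cyc not_T by blast
      then obtain v where v: "v \<in> U" "h v \<noteq> x"
        by blast
      then have "(h v, v) \<in> ?S1"
        using H one by blast
      from tri.spokes_on_one[OF this one xy(1,2) xyE(1) v(2)] show ?thesis
        using A B cardV k one by simp
    next
      case two
      have "g = {y, x}" "set c1 \<union> set c2 = set c2 \<union> set c1" "set c2 \<inter> set c1 = {}"
        using xy(3) disj by auto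
      then have "\<not> (\<forall>v\<in>U. h v = y)"
        using iso_graph[OF tri.card_T2 tri.card_T1 xy(2,1)] cyc not_T by blast
      then obtain v where v: "v \<in> U" "h v \<noteq> y"
        by blast
      then have "(h v, v) \<in> ?S2"
        using H two by blast
      from swapped.spokes_on_one[OF this two xy(2,1) xyE(2) v(2)] show ?thesis
        using A' B' cardV k two by simp
    qed
  next
    case False
    then obtain z w where z: "z \<in> U" "g = {z, w}"
      "h z \<in> set c1 \<and> w \<in> set c2 \<or> h z \<in> set c2 \<and> w \<in> set c1"
      using g unfolding U_def by blast
    have "{w, z} \<in> E"
      using Eeq z(2) by (auto simp: insert_commute)
    then have wz: "(w, z) \<in> ?S1 \<union> ?S2"
      using z by (auto simp: spokes_def)
    \<comment> \<open>The outer vertex \<open>z\<close> already has its chosen spoke to the other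
      triangle, so this one is the surplus.\<close>
    have "(w, z) \<notin> ?H"
      using z(3) disj by auto
    then have "card (insert (w, z) ?H) = card U + 1"
      using cardH tri.finite_U by simp
    moreover have "card (insert (w, z) ?H) \<le> card (?S1 \<union> ?S2)"
      using H wz by (intro card_mono finS) auto
    ultimately have k1: "card U + 1 \<le> card ?S1 + card ?S2"
      using cardS by simp
    have "(h z, z) \<in> ?S1 \<and> (w, z) \<in> ?S2 \<or> (h z, z) \<in> ?S2 \<and> (w, z) \<in> ?S1"
      using z hE[OF z(1)] \<open>{w, z} \<in> E\<close> by (auto simp: spokes_def)
    then obtain u1 u2 where uv: "(u1, z) \<in> ?S1" "(u2, z) \<in> ?S2"
      by blast
    have "tri.small_matchings \<noteq> {}"
      using M A by auto
    from tri.surplus_spoke[OF uv k1 this] show ?thesis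
      using A B cardV by simp
  qed
qed

lemma avm_gt_of_not_T:
  assumes n: "7 \<le> card V"
    and not_T: "\<not> graph_iso V E {0..<card V} (T_edges (card V))"
  shows "3 - 6 / real (3 * card V - 11) < avm E"
proof (rule avm_gt[OF finite_E card_maximal_matching_ge_2])
  let ?N = "{M. is_maximal_matching E M}"
  let ?A = "{M. is_maximal_matching E M \<and> card M = 2}"
  let ?B = "{M. is_maximal_matching E M \<and> 3 \<le> card M}"
  have fin: "finite ?N"
    by (rule finite_maximal_matchings[OF finite_E])
  show "card ?A * (3 * card V - 11) < 6 * card ?N"
  proof (cases "?A = {}")
    case True
    have "?N \<noteq> {}"
      using maximal_matching_extends[OF finite_E is_matching_empty] by blast
    then have "0 < card ?N"
      using fin by (simp add: card_gt_0_iff)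
    then show ?thesis
      unfolding True by simp
  next
    case False
    then obtain M where M: "is_maximal_matching E M" "card M = 2"
      by blast
    have "?N = ?A \<union> ?B"
      using card_maximal_matching_ge_2 by (force simp: le_eq_less_or_eq)
    moreover have "card (?A \<union> ?B) = card ?A + card ?B"
    proof (rule card_Un_disjoint)
      show "finite ?A" "finite ?B"
        using fin by (auto elim!: rev_finite_subset)
    qed auto
    moreover have "3 * card V - 11 = 3 * (card V - 6) + 7"
      using n by simp
    \<comment> \<open>Adding \<open>6 * a\<close> to both sides turns the comparison of small with
      large matchings into one of small with all matchings.\<close>
    moreover have "a * (3 * k + 7) < 6 * (a + b)" if "(3 * k + 1) * a < 6 * b" for a b k :: nat
      using that by (simp add: algebra_simps)
    ultimately show ?thesis
      using few_small_matchings[OF n M not_T] by (simp only:)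
  qed
  show "0 < 3 * card V - 11"
    using n by simp
qed

end

theorem theorem4p6:
  fixes V :: "'a set" and E :: "'a set set" and n :: nat
  assumes "n \<ge> 7"
    and "simple_graph V E"
    and "connected_graph V E"
    and "card V = n"
    and "card E = n + 1"
    and "\<exists>c1 c2. is_cycle E c1 \<and> is_cycle E c2 \<and> set c1 \<inter> set c2 = {}"
    and "\<not> graph_iso V E {0..<n} (T_edges n)"
  shows "avm E > avm (T_edges n)"
proof -
  obtain c1 c2 where "is_cycle E c1" "is_cycle E c2" "set c1 \<inter> set c2 = {}"
    using assms(6) by blast
  then interpret disjoint_cycles V E c1 c2
    using assms by unfold_locales auto
  have "avm (T_edges n) \<le> 3 - 6 / real (3 * n - 11)"
    by (rule avm_T_edges_le[OF assms(1)])
  also have "\<dots> < avm E"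
    using avm_gt_of_not_T assms(1,4,7) by simp
  finally show ?thesis .
qed

end
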